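(* Let $b\in\mathcal{B}$ and set $A(t)=\int_0^t\left(\gamma+\mu q(b(s))\right)ds$. Then $V_b$ is given by $$V_b(\tau)=e^{A(\tau)}\left(V_b(0)-\int_0^\tau e^{-A(t)}\,\mu\,U\left(V_b(0)+k(t),\,b(t)\right)dt\right),$$ $$V_b(0)=\mathbb{E}(N_b)\times\mathbb{E}\left(U(k(T_w),b(T_w))\ \big|\ T_w<T_\gamma\right).$$
   Context: Setting. Auctions arrive according to a Poisson process of intensity $\mu$. At the $i$-th auction the price to beat is $C_i\ge0$; the $C_i$ are i.i.d. with cumulative distribution function $q$, and $q(b)$ is the probability of winning with bid $b$. The age $\tau$ is the time elapsed since the last won auction: it grows at unit rate and is reset to $0$ after each win. An item won at age $\tau$ has value $k(\tau)$ for the bidder, where $k$ is a non-decreasing bounded function. A bidding policy is a measurable function $b:\tau\mapsto b(\tau)\in\mathbb{R}^+$, the bid submitted when the age is $\tau$; $\mathcal{B}$ is the set of such policies. The auctions are second price: the winner pays $C_i$. The average payment when bidding $b$ is $p(b)=q(b)b-\int_0^bq(t)\,dt$, and $U(v,b)=q(b)v-p(b)$ is the expected utility when bidding $b$ and valuing $v$ for winning. With discount rate $\gamma$, current age $\tau$, next auctions at times $T_1<T_2<\dots$ (measured from now), and $\tau(T_i)$ the age at the auction at time $T_i$ under policy $b$, set $$V_b(\tau)=\mathbb{E}\sum_{i\ge1}e^{-\gamma T_i}\left(k(\tau(T_i))-C_i\right)\mathbf{1}\{b(\tau(T_i))>C_i\}.$$ Equivalently, there is no discounting and the sequence of auctions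 ends at a random time $T_\gamma$ that is exponentially distributed with parameter $\gamma$. For the process started at age $0$ under policy $b$, $T_w$ is the age at the time of the next won auction, and $N_b$ is the number of won auctions until the end of the sequence $T_\gamma$.
   Formalization: In the second identity U(k(T_w),b(T_w)) is divided by q(b(T_w)); as printed it fails, e.g. for k=1, C_i uniform on [0,1], b=1/2. The expectation defining V_b(0) is assumed to converge absolutely (V_b(0) could be -∞), and prices have no atoms, as q is both cdf and winning probability. *)

theory Defs
  imports "HOL-Probability.Probability"
begin

text \<open>
  Auctions are indexed from 0. A Poisson process is given by its arrival times, whose
  successive gaps, the first one counted from time 0, are i.i.d. exponential. Positivity of
  the gaps on the whole space, not only almost surely, keeps all ages in \<open>{0..}\<close>; policies
  and \<open>k\<close> are unconstrained elsewhere, which could otherwise spoil measurability on null sets.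
\<close>

definition interarrival :: "(nat \<Rightarrow> 'a \<Rightarrow> real) \<Rightarrow> nat \<Rightarrow> 'a \<Rightarrow> real" where
  "interarrival T i \<omega> = (case i of 0 \<Rightarrow> T 0 \<omega> | Suc j \<Rightarrow> T (Suc j) \<omega> - T j \<omega>)"

definition poisson_arrivals :: "'a measure \<Rightarrow> real \<Rightarrow> (nat \<Rightarrow> 'a \<Rightarrow> real) \<Rightarrow> bool" where
  "poisson_arrivals M \<mu> T \<longleftrightarrow>
     (\<forall>i. \<forall>\<omega>\<in>space M. 0 < interarrival T i \<omega>) \<and>
     prob_space.indep_vars M (\<lambda>_. borel) (interarrival T) UNIV \<and>
     (\<forall>i. distributed M lborel (interarrival T i) (exponential_density \<mu>))"

text \<open>
  The index type of the independent sources of randomness: it lets a single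
  \<^const>\<open>prob_space.indep_vars\<close> express that the gaps, the prices and the end of the
  sequence are jointly independent.
\<close>

datatype source = Gap nat | Price nat | End

definition sources ::
  "(nat \<Rightarrow> 'a \<Rightarrow> real) \<Rightarrow> (nat \<Rightarrow> 'a \<Rightarrow> real) \<Rightarrow> ('a \<Rightarrow> real) \<Rightarrow> source \<Rightarrow> 'a \<Rightarrow> real" where
  "sources T C T\<^sub>\<gamma> s = (case s of Gap i \<Rightarrow> interarrival T i | Price i \<Rightarrow> C i | End \<Rightarrow> T\<^sub>\<gamma>)"

text \<open>Ages live in \<open>{0..}\<close>; the values of a policy at negative arguments are irrelevant.\<close>

definition policies :: "(real \<Rightarrow> real) set" where
  "policies = {b. b \<in> borel_measurable (restrict_space borel {0..}) \<and> (\<forall>\<tau>\<ge>0. 0 \<le> b \<tau>)}"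

definition payment :: "(real \<Rightarrow> real) \<Rightarrow> real \<Rightarrow> real" where
  "payment q \<beta> = q \<beta> * \<beta> - (LBINT t:{0..\<beta>}. q t)"

definition utility :: "(real \<Rightarrow> real) \<Rightarrow> real \<Rightarrow> real \<Rightarrow> real" where
  "utility q v \<beta> = q \<beta> * v - payment q \<beta>"

text \<open>
  The expected utility of bidding \<open>\<beta>\<close> in an auction that is known to be won:
  \<^const>\<open>utility\<close> averages over winning and losing, and losing yields 0.
  The expectation over the age of a won auction must use this one: with \<^const>\<open>utility\<close>
  the winning probability would be counted twice, and the identity for the value at age 0
  fails already for constant \<open>k\<close> and a constant bid that wins with probability 1/2.
\<close>

definition utility_given_win :: "(real \<Rightarrow> real) \<Rightarrow> real \<Rightarrow> real \<Rightarrow> real" where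
  "utility_given_win q v \<beta> = utility q v \<beta> / q \<beta>"

text \<open>
  In the following, \<open>t\<close> and \<open>c\<close> are realised sequences of auction times and prices, and
  \<open>\<tau>\<close> is the age at time 0.
\<close>

primrec auction_age :: "(real \<Rightarrow> real) \<Rightarrow> real \<Rightarrow> (nat \<Rightarrow> real) \<Rightarrow> (nat \<Rightarrow> real) \<Rightarrow> nat \<Rightarrow> real" where
  "auction_age b \<tau> t c 0 = \<tau> + t 0"
| "auction_age b \<tau> t c (Suc i) =
     (if c i < b (auction_age b \<tau> t c i) then 0 else auction_age b \<tau> t c i) + (t (Suc i) - t i)"

definition won :: "(real \<Rightarrow> real) \<Rightarrow> real \<Rightarrow> (nat \<Rightarrow> real) \<Rightarrow> (nat \<Rightarrow> real) \<Rightarrow> nat \<Rightarrow> bool" where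
  "won b \<tau> t c i \<longleftrightarrow> c i < b (auction_age b \<tau> t c i)"

definition discounted_gain ::
  "real \<Rightarrow> (real \<Rightarrow> real) \<Rightarrow> (real \<Rightarrow> real) \<Rightarrow> real \<Rightarrow> (nat \<Rightarrow> real) \<Rightarrow> (nat \<Rightarrow> real) \<Rightarrow> nat \<Rightarrow> real" where
  "discounted_gain \<gamma> k b \<tau> t c i =
     exp (- \<gamma> * t i) * (k (auction_age b \<tau> t c i) - c i) * of_bool (won b \<tau> t c i)"

definition policy_value ::
  "'a measure \<Rightarrow> real \<Rightarrow> (real \<Rightarrow> real) \<Rightarrow> (nat \<Rightarrow> 'a \<Rightarrow> real) \<Rightarrow> (nat \<Rightarrow> 'a \<Rightarrow> real) \<Rightarrow>
   (real \<Rightarrow> real) \<Rightarrow> real \<Rightarrow> real" where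
  "policy_value M \<gamma> k T C b \<tau> =
     (\<integral>\<omega>. (\<Sum>i. discounted_gain \<gamma> k b \<tau> (\<lambda>j. T j \<omega>) (\<lambda>j. C j \<omega>) i) \<partial>M)"

text \<open>
  Absolute convergence of the expectation of the series in \<^const>\<open>policy_value\<close>. Without it
  that expectation can be \<open>-\<infinity>\<close>, since neither the bids nor the mean price need be bounded.
\<close>

definition value_converges ::
  "'a measure \<Rightarrow> real \<Rightarrow> (real \<Rightarrow> real) \<Rightarrow> (nat \<Rightarrow> 'a \<Rightarrow> real) \<Rightarrow> (nat \<Rightarrow> 'a \<Rightarrow> real) \<Rightarrow>
   (real \<Rightarrow> real) \<Rightarrow> real \<Rightarrow> bool" where
  "value_converges M \<gamma> k T C b \<tau> \<longleftrightarrow>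
     (\<integral>\<^sup>+\<omega>. (\<Sum>i. ennreal \<bar>discounted_gain \<gamma> k b \<tau> (\<lambda>j. T j \<omega>) (\<lambda>j. C j \<omega>) i\<bar>) \<partial>M) < \<infinity>"

text \<open>The age at the first win of the process started at age 0, infinite if there is none.\<close>

definition win_age :: "(real \<Rightarrow> real) \<Rightarrow> (nat \<Rightarrow> real) \<Rightarrow> (nat \<Rightarrow> real) \<Rightarrow> ereal" where
  "win_age b t c =
     (if \<exists>i. won b 0 t c i then ereal (auction_age b 0 t c (LEAST i. won b 0 t c i)) else \<infinity>)"

definition number_won :: "(real \<Rightarrow> real) \<Rightarrow> (nat \<Rightarrow> real) \<Rightarrow> (nat \<Rightarrow> real) \<Rightarrow> real \<Rightarrow> nat" where
  "number_won b t c s = card {i. t i \<le> s \<and> won b 0 t c i}"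

text \<open>Conditional expectation given an event of positive probability; 0 for a null event.\<close>

definition expectation_given :: "'a measure \<Rightarrow> ('a \<Rightarrow> real) \<Rightarrow> 'a set \<Rightarrow> real" where
  "expectation_given M X E = (\<integral>\<omega>. X \<omega> \<partial>uniform_measure M E)"

definition cumulative_rate :: "real \<Rightarrow> real \<Rightarrow> (real \<Rightarrow> real) \<Rightarrow> (real \<Rightarrow> real) \<Rightarrow> real \<Rightarrow> real" where
  "cumulative_rate \<gamma> \<mu> q b t = (LBINT s:{0..t}. \<gamma> + \<mu> * q (b s))"

end

theory Submission
  imports Defs
begin

text \<open>
  Between auctions nothing happens, so the sequence of (gap, price) pairs drives everything, and
  conditioning on its first pair turns the expected discounted gains from age \<open>a\<close> into
  \<open>R a = E e\<^bsup>-\<gamma>G\<^esup> (u + p R 0 + (1 - p) R)(a + G)\<close>. Here \<open>G\<close> is exponential, \<open>p\<close> the winning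
  probability at a given age and \<open>u\<close> the expected gain of the auction. Written as an integral over
  \<open>{a..}\<close>, this is a linear equation for \<open>e\<^bsup>-(\<mu>+\<gamma>)a\<^esup> R a\<close>, solved by the integrating factor
  \<open>exp (\<integral> \<mu> (1 - p))\<close>, which gives the first identity. For the second one, renewal at the first win
  gives \<open>R 0 = D 0 + R 0 \<cdot> P(T\<^sub>w < T\<^sub>\<gamma>)\<close>, where \<open>D\<close> only collects the gain of the first win. With
  \<open>u = p\<close> the same relation gives the expected number of wins, and \<open>D\<close> sees the price only
  through \<open>u\<close>. Gains are split into positive and negative parts, so that most of the argument
  runs in \<^typ>\<open>ennreal\<close> without integrability conditions.
\<close>

section \<open>A linear integral equation\<close>

text \<open>The one-step equation contains \<open>R 0\<close> at every age. It is carried along as a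
  constant of the data, so solving the equation only expresses \<open>R a\<close> through
  \<open>R 0\<close>, and the value at age 0 needs its own argument. Subtraction is postponed:
  positive and negative gains are solved separately, each with its own constant at age 0, and only
  finite quantities are ever subtracted. Convergence is given at age 0 only; it spreads to later
  ages because the tail integral over \<open>{a..}\<close> is dominated by the one over
  \<open>{0..}\<close>. For the second identity let p = P(T_w < T_gamma). Renewal gives V(0) (1 - p)
  = D and E(N) (1 - p) = p, hence V(0) = E(N) D / p, and D / p is the conditional expectation. The
  factor 1 - p can be cancelled because already the first auction has to precede the end, which
  happens with probability \<mu> / (\<mu> + \<gamma>) < 1.\<close>

lemma ode_increment_bound:
  fixes y f a :: "real \<Rightarrow> real" and m :: real
  defines "B \<equiv> \<lambda>t. integral {0..t} a"
  assumes st: "0 \<le> s" "s \<le> t"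
    and a: "a integrable_on {0..t}" "\<And>u. 0 \<le> a u" "\<And>u. a u \<le> m"
    and f: "f integrable_on {0..t}" "\<And>u. 0 \<le> u \<Longrightarrow> 0 \<le> f u"
    and af: "(\<lambda>u. a u * y u) integrable_on {0..t}"
    and Ef: "(\<lambda>u. exp (B u) * f u) integrable_on {0..t}"
    and y: "\<And>u. 0 \<le> u \<Longrightarrow> 0 \<le> y u"
    and eq: "\<And>u. 0 \<le> u \<Longrightarrow> u \<le> t \<Longrightarrow> y u = y 0 - integral {0..u} (\<lambda>u. f u + a u * y u)"
  shows "\<bar>y t * exp (B t) - y s * exp (B s) + integral {s..t} (\<lambda>u. exp (B u) * f u)\<bar>
     \<le> exp (B t) * (m * (t - s)) * (y s - y t + y 0 * (m * (t - s)))"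
proof -
  have sub: "{c..d} \<subseteq> {0..t}" if "0 \<le> c" "d \<le> t" for c d using that by auto
  note ion = integrable_on_subinterval[OF _ sub]
  have fay: "(\<lambda>u. f u + a u * y u) integrable_on {0..t}" using f af by (intro integrable_add)
  have inc: "y v - y u = - integral {u..v} (\<lambda>u. f u + a u * y u)" if "0 \<le> u" "u \<le> v" "v \<le> t" for u v
  proof -
    have "integral {0..u} (\<lambda>u. f u + a u * y u) + integral {u..v} (\<lambda>u. f u + a u * y u) = integral {0..v} (\<lambda>u. f u + a u * y u)"
      using that by (intro Henstock_Kurzweil_Integration.integral_combine ion[OF fay]) auto
    then show ?thesis using eq[of u] eq[of v] that by simp
  qed
  have ymono: "y v \<le> y u" if "0 \<le> u" "u \<le> v" "v \<le> t" for u v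
  proof -
    have "0 \<le> integral {u..v} (\<lambda>u. f u + a u * y u)"
      using that f(2) a(2) y by (intro integral_nonneg ion[OF fay]) auto
    then show ?thesis using inc[OF that] by simp
  qed
  have Binc: "B v - B u = integral {u..v} a" if "0 \<le> u" "u \<le> v" "v \<le> t" for u v
  proof -
    have "integral {0..u} a + integral {u..v} a = integral {0..v} a"
      using that by (intro Henstock_Kurzweil_Integration.integral_combine ion[OF a(1)]) auto
    then show ?thesis by (simp add: B_def)
  qed
  have Bmono: "B u \<le> B v" if "0 \<le> u" "u \<le> v" "v \<le> t" for u v
  proof -
    have "0 \<le> integral {u..v} a"
      using that a(2) by (intro integral_nonneg ion[OF a(1)]) auto
    then show ?thesis using Binc[OF that] by simp
  qed
  define \<alpha> where "\<alpha> = integral {s..t} a"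
  define \<phi> where "\<phi> = integral {s..t} f"
  define \<psi> where "\<psi> = integral {s..t} (\<lambda>u. a u * y u)"
  define \<xi> where "\<xi> = integral {s..t} (\<lambda>u. exp (B u) * f u)"
  define E where "E = exp (B t)"
  define E' where "E' = exp (B s)"
  have i: "a integrable_on {s..t}" "f integrable_on {s..t}" "(\<lambda>u. a u * y u) integrable_on {s..t}"
     "(\<lambda>u. exp (B u) * f u) integrable_on {s..t}"
    using st by (auto intro!: ion a f af Ef)
  have \<alpha>B: "B t = B s + \<alpha>" using Binc[of s t] st by (simp add: \<alpha>_def)
  have \<alpha>0: "0 \<le> \<alpha>" unfolding \<alpha>_def using a by (intro integral_nonneg i) auto
  have \<alpha>m: "\<alpha> \<le> m * (t - s)"
  proof -
    have "\<alpha> \<le> integral {s..t} (\<lambda>_. m)" unfolding \<alpha>_def using a by (intro integral_le i) auto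
    then show ?thesis using st by (simp add: mult.commute)
  qed
  have \<phi>0: "0 \<le> \<phi>" unfolding \<phi>_def using f st by (intro integral_nonneg i) auto
  have \<psi>1: "\<alpha> * y t \<le> \<psi>"
  proof -
    have "integral {s..t} (\<lambda>u. a u * y t) \<le> \<psi>" unfolding \<psi>_def
      using a ymono st by (intro integral_le i integrable_on_mult_left mult_left_mono) auto
    then show ?thesis by (simp add: \<alpha>_def)
  qed
  have \<psi>2: "\<psi> \<le> \<alpha> * y s"
  proof -
    have "\<psi> \<le> integral {s..t} (\<lambda>u. a u * y s)" unfolding \<psi>_def
      using a ymono st by (intro integral_le i integrable_on_mult_left mult_left_mono) auto
    then show ?thesis by (simp add: \<alpha>_def)
  qed
  have \<psi>0: "0 \<le> \<psi>" unfolding \<psi>_def using a y st by (intro integral_nonneg i) auto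
  have \<xi>1: "E' * \<phi> \<le> \<xi>"
  proof -
    have "integral {s..t} (\<lambda>u. E' * f u) \<le> \<xi>" unfolding \<xi>_def E'_def
      using f Bmono st by (intro integral_le i integrable_on_mult_right mult_right_mono) auto
    then show ?thesis by (simp add: \<phi>_def)
  qed
  have \<xi>2: "\<xi> \<le> E * \<phi>"
  proof -
    have "\<xi> \<le> integral {s..t} (\<lambda>u. E * f u)" unfolding \<xi>_def E_def
      using f Bmono st by (intro integral_le i integrable_on_mult_right mult_right_mono) auto
    then show ?thesis by (simp add: \<phi>_def)
  qed
  have yst: "y t - y s = - (\<phi> + \<psi>)"
    using inc[of s t] st i by (simp add: \<phi>_def \<psi>_def integral_add)
  have E1: "E - E' \<le> E * \<alpha>"
  proof -
    have "1 - \<alpha> \<le> exp (- \<alpha>)" using exp_ge_add_one_self[of "-\<alpha>"] by simp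
    then have "E * (1 - \<alpha>) \<le> E * exp (-\<alpha>)" by (intro mult_left_mono) (auto simp: E_def)
    also have "E * exp (-\<alpha>) = E'" by (simp add: E_def E'_def \<alpha>B exp_add exp_minus)
    finally show ?thesis by (simp add: algebra_simps)
  qed
  have E2: "E' * \<alpha> \<le> E - E'"
  proof -
    have "E' * (1 + \<alpha>) \<le> E' * exp \<alpha>" by (intro mult_left_mono) (auto simp: E'_def)
    also have "\<dots> = E" by (simp add: E_def E'_def \<alpha>B exp_add)
    finally show ?thesis by (simp add: algebra_simps)
  qed
  have pos: "0 < E" "0 < E'" by (auto simp: E_def E'_def)
  have ys0: "0 \<le> y s" "y s \<le> y 0" "0 \<le> y t" using y ymono[of 0 s] st by auto
  have yy: "0 \<le> y s - y t" using yst \<phi>0 \<psi>0 by linarith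
  let ?D = "y t * E - y s * E' + \<xi>"
  \<comment> \<open>To first order \<open>E - E'\<close> is \<open>E * \<alpha>\<close>,
    \<open>\<psi>\<close> is \<open>\<alpha>\<close> times a value of \<open>y\<close>, and
    \<open>\<xi>\<close> is \<open>E * \<phi>\<close>, so everything cancels. As \<open>y\<close>
    and \<open>exp B\<close> are monotone, replacing them by end values costs only products of two
    increments. This is the form of the bound: one factor is small with the mesh, the other one
    telescopes when summed over a partition.\<close>
  have D: "?D = y s * (E - E') - (\<phi> + \<psi>) * E + \<xi>"
    using yst by (simp add: algebra_simps) (metis (no_types, lifting) add_diff_cancel_left' diff_add_eq distrib_left left_diff_distrib mult.commute)
  have up: "?D \<le> E * \<alpha> * (y s - y t)"
  proof -
    have "y s * (E - E') \<le> y s * (E * \<alpha>)" using E1 ys0 by (intro mult_left_mono) auto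
    moreover have "E * (\<alpha> * y t) \<le> E * \<psi>" using \<psi>1 pos by (intro mult_left_mono) auto
    ultimately show ?thesis unfolding D using \<xi>2 by (simp add: algebra_simps)
  qed
  \<comment> \<open>The extra \<open>y s * \<alpha>\<close> is the second-order error of the
    exponential: \<open>E1\<close> and \<open>E2\<close> together put \<open>E - E'\<close> between
    \<open>E * \<alpha> - E * \<alpha> * \<alpha>\<close> and \<open>E * \<alpha>\<close>.\<close>
  have lo: "- (E * \<alpha> * (y s - y t + y s * \<alpha>)) \<le> ?D"
  proof -
    have "E * \<psi> \<le> E * (\<alpha> * y s)" using \<psi>2 pos by (intro mult_left_mono) auto
    then have 1: "?D \<ge> y s * (E - E' - E * \<alpha>) - (E - E') * \<phi>"
      unfolding D using \<xi>1 by (simp add: algebra_simps)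
    have "(E - E') * \<alpha> \<le> E * \<alpha> * \<alpha>" using E1 \<alpha>0 by (intro mult_right_mono) auto
    then have "E - E' - E * \<alpha> \<ge> - (E * \<alpha> * \<alpha>)" using E2 by (simp add: algebra_simps)
    then have 2: "y s * (E - E' - E * \<alpha>) \<ge> y s * (- (E * \<alpha> * \<alpha>))" using ys0 by (intro mult_left_mono) auto
    have "\<phi> \<le> y s - y t" using yst \<psi>0 by simp
    moreover have "0 \<le> E - E'" using E2 \<alpha>0 pos by (smt (verit) mult_nonneg_nonneg)
    ultimately have "(E - E') * \<phi> \<le> E * \<alpha> * (y s - y t)"
      using E1 \<phi>0 yy pos \<alpha>0 by (intro mult_mono) auto
    then show ?thesis using 1 2 by (simp add: algebra_simps)
  qed
  have m0: "0 \<le> m * (t - s)" using \<alpha>0 \<alpha>m by simp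
  have "\<bar>?D\<bar> \<le> E * \<alpha> * (y s - y t + y s * \<alpha>)"
  proof (rule abs_leI)
    have "E * \<alpha> * (y s - y t) \<le> E * \<alpha> * (y s - y t + y s * \<alpha>)"
      using pos \<alpha>0 ys0 by (intro mult_left_mono) auto
    then show "?D \<le> E * \<alpha> * (y s - y t + y s * \<alpha>)" using up by simp
  qed (use lo in simp)
  also have "\<dots> \<le> E * (m * (t - s)) * (y s - y t + y 0 * (m * (t - s)))"
    using st order_trans[OF a(2) a(3)] \<alpha>m \<alpha>0 ys0 pos yy m0 by (intro mult_mono add_mono mult_nonneg_nonneg add_nonneg_nonneg) auto
  finally show ?thesis by (simp add: E_def E'_def \<xi>_def)
qed

text \<open>
  The data \<open>f\<close> and \<open>a\<close> are merely integrable, so there is no derivative to work with. Instead, the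
  increments of \<open>y exp B + \<integral> exp B f\<close> over a partition of mesh \<open>h\<close> are \<open>O(h)\<close> times the increments of
  the monotone functions \<open>-y\<close> and \<open>id\<close>, hence their sum is \<open>O(h)\<close>.
\<close>

lemma linear_integral_equation:
  fixes y f a :: "real \<Rightarrow> real" and m :: real
  defines "B \<equiv> \<lambda>t. integral {0..t} a"
  assumes t: "0 \<le> t"
    and a: "a integrable_on {0..t}" "\<And>u. 0 \<le> a u" "\<And>u. a u \<le> m"
    and f: "f integrable_on {0..t}" "\<And>u. 0 \<le> u \<Longrightarrow> 0 \<le> f u"
    and af: "(\<lambda>u. a u * y u) integrable_on {0..t}"
    and Ef: "(\<lambda>u. exp (B u) * f u) integrable_on {0..t}"
    and y: "\<And>u. 0 \<le> u \<Longrightarrow> 0 \<le> y u"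
    and eq: "\<And>u. 0 \<le> u \<Longrightarrow> u \<le> t \<Longrightarrow> y u = y 0 - integral {0..u} (\<lambda>u. f u + a u * y u)"
  shows "y t * exp (B t) = y 0 - integral {0..t} (\<lambda>u. exp (B u) * f u)"
proof -
  define \<Psi> where "\<Psi> = (\<lambda>u. y u * exp (B u) + integral {0..u} (\<lambda>u. exp (B u) * f u))"
  have m0: "0 \<le> m" using a(2)[of 0] a(3)[of 0] by linarith
  have Bmono: "B u \<le> B t" if "0 \<le> u" "u \<le> t" for u
  proof -
    have "integral {0..u} a \<le> integral {0..t} a"
      using a(2) that by (intro integral_subset_le integrable_on_subinterval[OF a(1)]) (auto simp: a)
    then show ?thesis by (simp add: B_def)
  qed
  \<comment> \<open>The bracket bounds the sum of the second factors over a whole partition: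
    \<open>y\<close> falls by at most \<open>y 0\<close> in total, and the terms
    \<open>y 0 * (m * h)\<close> add up to \<open>y 0 * m * t\<close>. The remaining factor, the
    mesh, is \<open>t / real n\<close>.\<close>
  define K where "K = exp (B t) * m * (y 0 + y 0 * m * t)"
  have bound: "\<bar>\<Psi> t - \<Psi> 0\<bar> \<le> K * t / real n" if n: "n > 0" for n :: nat
  proof -
    define h where "h = t / real n"
    define p where "p i = real i * h" for i
    have h0: "0 \<le> h" using t by (simp add: h_def)
    have p: "0 \<le> p i" "p i \<le> p (Suc i)" "p (Suc i) - p i = h" for i using h0 by (auto simp: p_def algebra_simps)
    have pn: "p n = t" using n by (simp add: p_def h_def)
    have pt: "p i \<le> t" if "i \<le> n" for i
      unfolding pn[symmetric] p_def using that h0 by (intro mult_right_mono) auto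
    have step: "\<bar>\<Psi> (p (Suc i)) - \<Psi> (p i)\<bar> \<le> exp (B t) * (m * h) * (y (p i) - y (p (Suc i)) + y 0 * (m * h))"
      if i: "i < n" for i
    proof -
      let ?s = "p i" and ?t = "p (Suc i)"
      have le: "?t \<le> t" using pt[of "Suc i"] i by simp
      have sub: "{0..?t} \<subseteq> {0..t}" using le by auto
      have "\<bar>y ?t * exp (B ?t) - y ?s * exp (B ?s) + integral {?s..?t} (\<lambda>u. exp (B u) * f u)\<bar>
        \<le> exp (B ?t) * (m * (?t - ?s)) * (y ?s - y ?t + y 0 * (m * (?t - ?s)))"
        unfolding B_def
        using p le a f y
        by (intro ode_increment_bound integrable_on_subinterval[OF _ sub] a f af Ef[unfolded B_def] eq) auto
      moreover have "integral {0..?s} (\<lambda>u. exp (B u) * f u) + integral {?s..?t} (\<lambda>u. exp (B u) * f u)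
         = integral {0..?t} (\<lambda>u. exp (B u) * f u)"
        using p by (intro Henstock_Kurzweil_Integration.integral_combine integrable_on_subinterval[OF Ef sub]) auto
      ultimately have "\<bar>\<Psi> ?t - \<Psi> ?s\<bar> \<le> exp (B ?t) * (m * h) * (y ?s - y ?t + y 0 * (m * h))"
        by (simp add: \<Psi>_def p(3) algebra_simps)
      also have "\<dots> \<le> exp (B t) * (m * h) * (y ?s - y ?t + y 0 * (m * h))"
      proof (intro mult_right_mono)
        show "exp (B ?t) \<le> exp (B t)" using Bmono[of ?t] p le by simp
        have "integral {0..?s} (\<lambda>u. f u + a u * y u) \<le> integral {0..?t} (\<lambda>u. f u + a u * y u)"
          using p f a y le pt[of i] i
          by (intro integral_subset_le integrable_on_subinterval[OF integrable_add[OF f(1) af]])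
             (auto intro!: add_nonneg_nonneg mult_nonneg_nonneg)
        then have "y ?t \<le> y ?s" using eq[of ?s] eq[of ?t] p le pt[of i] i by simp
        then show "0 \<le> y ?s - y ?t + y 0 * (m * h)" using y[of 0] m0 h0 by simp
      qed (use m0 h0 in auto)
      finally show ?thesis .
    qed
    have "\<bar>\<Psi> t - \<Psi> 0\<bar> = \<bar>\<Sum>i<n. \<Psi> (p (Suc i)) - \<Psi> (p i)\<bar>"
      by (subst sum_lessThan_telescope) (simp add: pn, simp add: p_def)
    also have "\<dots> \<le> (\<Sum>i<n. exp (B t) * (m * h) * (y (p i) - y (p (Suc i)) + y 0 * (m * h)))"
      by (rule order_trans[OF sum_abs]) (intro sum_mono step, simp)
    also have "\<dots> = exp (B t) * (m * h) * ((\<Sum>i<n. y (p i) - y (p (Suc i))) + real n * (y 0 * (m * h)))"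
      by (simp add: sum_distrib_left[symmetric] sum.distrib)
    also have "(\<Sum>i<n. y (p i) - y (p (Suc i))) = y 0 - y t"
      by (subst sum_lessThan_telescope') (simp add: pn, simp add: p_def)
    also have "real n * (y 0 * (m * h)) = y 0 * m * t" using n by (simp add: h_def)
    also have "exp (B t) * (m * h) * (y 0 - y t + y 0 * m * t) \<le> exp (B t) * (m * h) * (y 0 + y 0 * m * t)"
      using y[OF t] m0 h0 by (intro mult_left_mono) auto
    also have "\<dots> = K * t / real n" by (simp add: K_def h_def)
    finally show ?thesis .
  qed
  have "(\<lambda>n. K * t / real n) \<longlonglongrightarrow> 0" by (rule lim_const_over_n)
  then have "\<bar>\<Psi> t - \<Psi> 0\<bar> \<le> 0"
    by (rule LIMSEQ_le_const) (use bound in \<open>auto intro!: exI[of _ 1]\<close>)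
  then have "\<Psi> t = \<Psi> 0" by simp
  then show ?thesis by (simp add: \<Psi>_def B_def)
qed

section \<open>Gains along a sequence of auctions\<close>

definition arrivals :: "(nat \<Rightarrow> real \<times> real) \<Rightarrow> nat \<Rightarrow> real" where
  "arrivals x n = (\<Sum>j\<le>n. fst (x j))"

lemma arrivals_0 [simp]: "arrivals x 0 = fst (x 0)"
  and arrivals_Suc: "arrivals x (Suc n) = arrivals x n + fst (x (Suc n))"
  by (simp_all add: arrivals_def)

lemma arrivals_case_nat_Suc: "arrivals (case_nat z x) (Suc n) = fst z + arrivals x n"
  by (induction n) (simp_all add: arrivals_Suc)

locale bidding = Q: prob_space Q for Q :: "real measure" +
  fixes \<mu> \<gamma> :: real and b :: "real \<Rightarrow> real"
  assumes mu_pos: "0 < \<mu>" and gamma_pos: "0 < \<gamma>"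
    and sets_Q [measurable_cong]: "sets Q = sets borel"
    and measurable_b [measurable]: "b \<in> borel_measurable borel"
begin

definition gap_law :: "real measure" where
  "gap_law = density lborel (exponential_density \<mu>)"

definition auction_law :: "(real \<times> real) measure" where
  "auction_law = gap_law \<Otimes>\<^sub>M Q"

definition path_law :: "(nat \<Rightarrow> real \<times> real) measure" where
  "path_law = PiM UNIV (\<lambda>_. auction_law)"

lemma sets_gap_law [measurable_cong]: "sets gap_law = sets borel"
  by (simp add: gap_law_def)

lemma sets_auction_law [measurable_cong]: "sets auction_law = sets (borel \<Otimes>\<^sub>M borel)"
  unfolding auction_law_def by (intro sets_pair_measure_cong sets_gap_law sets_Q)

lemma sets_path_law [measurable_cong]: "sets path_law = sets (PiM UNIV (\<lambda>_::nat. borel \<Otimes>\<^sub>M borel))"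
  unfolding path_law_def by (intro sets_PiM_cong) (auto simp: sets_auction_law)

lemma prob_space_gap_law: "prob_space gap_law"
  unfolding gap_law_def using mu_pos by (rule prob_space_exponential_density)

sublocale gap: prob_space gap_law
  by (rule prob_space_gap_law)

sublocale gap_Q: pair_prob_space gap_law Q ..

sublocale auction: prob_space auction_law
  unfolding auction_law_def by (rule gap_Q.P.prob_space_axioms)

sublocale path: sequence_space auction_law
  by unfold_locales

sublocale path_law: prob_space path_law
  unfolding path_law_def by (rule path.prob_space_axioms)

section \<open>Winning probabilities and discounting over one gap\<close>

definition win :: "real \<Rightarrow> ennreal" where "win a = emeasure Q {..<b a}"

text \<open>A function of its own, so that the recursions in ennreal use only sums and products,
  never a truncated subtraction \<open>1 - win a\<close>.\<close>

definition lose :: "real \<Rightarrow> ennreal" where "lose a = emeasure Q {b a..}"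

lemma win_eq: "win a = (\<integral>\<^sup>+c. of_bool (c < b a) \<partial>Q)"
proof -
  have "(\<integral>\<^sup>+c. of_bool (c < b a) \<partial>Q) = (\<integral>\<^sup>+c. indicator {..<b a} c \<partial>Q)"
    by (intro nn_integral_cong) (auto simp: indicator_def)
  then show ?thesis by (simp add: win_def sets_Q)
qed

lemma lose_eq: "lose a = (\<integral>\<^sup>+c. of_bool (b a \<le> c) \<partial>Q)"
proof -
  have "(\<integral>\<^sup>+c. of_bool (b a \<le> c) \<partial>Q) = (\<integral>\<^sup>+c. indicator {b a..} c \<partial>Q)"
    by (intro nn_integral_cong) (auto simp: indicator_def)
  then show ?thesis by (simp add: lose_def sets_Q)
qed

lemma measurable_win [measurable]: "win \<in> borel_measurable borel"
  unfolding win_eq by measurable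

lemma measurable_lose [measurable]: "lose \<in> borel_measurable borel"
  unfolding lose_eq by measurable

lemma win_plus_lose: "win a + lose a = 1"
proof -
  have "win a + lose a = emeasure Q ({..<b a} \<union> {b a..})"
    unfolding win_def lose_def by (rule plus_emeasure) (auto simp: sets_Q)
  also have "{..<b a} \<union> {b a..} = space Q" using sets_eq_imp_space_eq[OF sets_Q] by auto
  finally show ?thesis by (simp add: Q.emeasure_space_1)
qed

text \<open>Up to the factor \<mu> this is the resolvent, at \<mu> + \<gamma>, of the semigroup of
  translations: between auctions the age just moves at unit rate.\<close>

definition discounted :: "(real \<Rightarrow> ennreal) \<Rightarrow> real \<Rightarrow> ennreal" where
  "discounted f a = (\<integral>\<^sup>+s. ennreal (exp (- \<gamma> * s)) * f (a + s) \<partial>gap_law)"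

lemma measurable_discounted [measurable]:
  assumes [measurable]: "f \<in> borel_measurable borel"
  shows "discounted f \<in> borel_measurable borel"
  unfolding discounted_def by measurable

lemma discounted_mono: "(\<And>a. f a \<le> g a) \<Longrightarrow> discounted f a \<le> discounted g a"
  unfolding discounted_def by (intro nn_integral_mono mult_left_mono) auto

lemma discounted_add:
  assumes [measurable]: "f \<in> borel_measurable borel" "g \<in> borel_measurable borel"
  shows "discounted (\<lambda>a. f a + g a) a = discounted f a + discounted g a"
  unfolding discounted_def by (subst nn_integral_add[symmetric]) (auto simp: distrib_left)

lemma discounted_cmult:
  assumes [measurable]: "f \<in> borel_measurable borel"
  shows "discounted (\<lambda>a. c * f a) a = c * discounted f a"
  unfolding discounted_def by (subst nn_integral_cmult[symmetric]) (auto simp: ac_simps)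

lemma discounted_sum:
  assumes "\<And>i. i \<in> I \<Longrightarrow> f i \<in> borel_measurable borel"
  shows "discounted (\<lambda>a. \<Sum>i\<in>I. f i a) a = (\<Sum>i\<in>I. discounted (f i) a)"
  using assms
proof (induction I rule: infinite_finite_induct)
  case (insert i I)
  then show ?case by (simp add: discounted_add)
qed (simp_all add: discounted_def)

lemma discounted_suminf:
  assumes [measurable]: "\<And>i. f i \<in> borel_measurable borel"
  shows "discounted (\<lambda>a. \<Sum>i. f i a) a = (\<Sum>i. discounted (f i) a)"
  unfolding discounted_def
  by (subst nn_integral_suminf[symmetric]) (auto simp: ennreal_suminf_cmult)

text \<open>Substituting \<open>t = a + s\<close> moves the starting age out of the integrand, into
  an explicit factor and the lower limit. This is what turns the one-step equation into an integral
  equation in the age.\<close>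

lemma discounted_eq_lborel:
  assumes [measurable]: "f \<in> borel_measurable borel"
  shows "discounted f a =
    ennreal (exp ((\<mu> + \<gamma>) * a)) * (\<integral>\<^sup>+t\<in>{a..}. ennreal (\<mu> * exp (- (\<mu> + \<gamma>) * t)) * f t \<partial>lborel)"
proof -
  have "discounted f a = (\<integral>\<^sup>+s. ennreal (exponential_density \<mu> s) * (ennreal (exp (- \<gamma> * s)) * f (a + s)) \<partial>lborel)"
    unfolding discounted_def gap_law_def
    by (subst nn_integral_density) auto
  also have "\<dots> = (\<integral>\<^sup>+s. ennreal (exponential_density \<mu> (- a + 1 * s)) * (ennreal (exp (- \<gamma> * (- a + 1 * s))) * f (a + (- a + 1 * s))) \<partial>lborel)"
    by (subst nn_integral_real_affine[where c=1 and t="-a"]) auto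
  also have "\<dots> = (\<integral>\<^sup>+t. ennreal (exp ((\<mu> + \<gamma>) * a)) * (ennreal (\<mu> * exp (- (\<mu> + \<gamma>) * t)) * f t * indicator {a..} t) \<partial>lborel)"
  proof (intro nn_integral_cong)
    fix t
    have *: "ennreal (exponential_density \<mu> (- a + 1 * t)) * ennreal (exp (- \<gamma> * (- a + 1 * t))) =
        ennreal (exp ((\<mu> + \<gamma>) * a)) * ennreal (\<mu> * exp (- (\<mu> + \<gamma>) * t))" if "a \<le> t"
    proof -
      have "exponential_density \<mu> (t - a) * exp (- \<gamma> * (t - a)) = exp ((\<mu> + \<gamma>) * a) * (\<mu> * exp (- (\<mu> + \<gamma>) * t))"
        using that by (simp add: exponential_density_def exp_add[symmetric] algebra_simps)
      then show ?thesis using mu_pos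
        by (simp add: ennreal_mult''[symmetric])
    qed
    show "ennreal (exponential_density \<mu> (- a + 1 * t)) * (ennreal (exp (- \<gamma> * (- a + 1 * t))) * f (a + (- a + 1 * t)))
      = ennreal (exp ((\<mu> + \<gamma>) * a)) * (ennreal (\<mu> * exp (- (\<mu> + \<gamma>) * t)) * f t * indicator {a..} t)"
    proof (cases "a \<le> t")
      case True
      have "a + (- a + 1 * t) = t" by simp
      then show ?thesis using True
        by (simp only: mult.assoc[symmetric] *[OF True]) simp
    qed (simp add: exponential_density_def)
  qed
  finally show ?thesis by (simp add: nn_integral_cmult)
qed

text \<open>A race of two exponential clocks: the constant is the probability that the gap ends
  before an independent clock of rate \<gamma>. Discounting tilts the density of rate \<mu> into a
  multiple of the density of rate \<mu> + \<gamma>.\<close>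

lemma discounted_const: "discounted (\<lambda>_. c) a = ennreal (\<mu> / (\<mu> + \<gamma>)) * c"
proof -
  interpret E: prob_space "density lborel (exponential_density (\<mu> + \<gamma>))"
    using mu_pos gamma_pos by (intro prob_space_exponential_density) simp
  have "discounted (\<lambda>_. c) a = (\<integral>\<^sup>+s. ennreal (exp (- \<gamma> * s)) * c \<partial>gap_law)"
    by (simp add: discounted_def)
  also have "\<dots> = (\<integral>\<^sup>+s. ennreal (exponential_density \<mu> s) * (ennreal (exp (- \<gamma> * s)) * c) \<partial>lborel)"
    unfolding gap_law_def by (subst nn_integral_density) auto
  also have "\<dots> = (\<integral>\<^sup>+s. (ennreal (\<mu> / (\<mu> + \<gamma>)) * c) * ennreal (exponential_density (\<mu> + \<gamma>) s) \<partial>lborel)"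
  proof (intro nn_integral_cong)
    fix s
    have "ennreal (exponential_density \<mu> s) * ennreal (exp (- \<gamma> * s)) = ennreal (\<mu> / (\<mu> + \<gamma>)) * ennreal (exponential_density (\<mu> + \<gamma>) s)"
      using mu_pos gamma_pos
      by (subst (1 2) ennreal_mult''[symmetric])
         (auto simp: exponential_density_def exp_add[symmetric] field_simps)
    then show "ennreal (exponential_density \<mu> s) * (ennreal (exp (- \<gamma> * s)) * c) = (ennreal (\<mu> / (\<mu> + \<gamma>)) * c) * ennreal (exponential_density (\<mu> + \<gamma>) s)"
      by (simp only: mult.assoc[symmetric]) (simp only: mult.assoc mult.commute[of c])
  qed
  also have "\<dots> = (ennreal (\<mu> / (\<mu> + \<gamma>)) * c) * (\<integral>\<^sup>+s. ennreal (exponential_density (\<mu> + \<gamma>) s) \<partial>lborel)"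
    by (rule nn_integral_cmult) auto
  also have "(\<integral>\<^sup>+s. ennreal (exponential_density (\<mu> + \<gamma>) s) \<partial>lborel) = 1"
    using E.emeasure_space_1 by (simp add: emeasure_density)
  finally show ?thesis by simp
qed

text \<open>
  Every earlier win multiplies a gain by \<open>\<rho>\<close>: all wins count for \<open>\<rho> = 1\<close>, only the first one
  for \<open>\<rho> = 0\<close>.
\<close>

primrec nth_gain :: "ennreal \<Rightarrow> (real \<Rightarrow> ennreal) \<Rightarrow> nat \<Rightarrow> real \<Rightarrow> ennreal" where
  "nth_gain \<rho> u 0 = discounted u"
| "nth_gain \<rho> u (Suc n) = discounted (\<lambda>a. \<rho> * win a * nth_gain \<rho> u n 0 + lose a * nth_gain \<rho> u n a)"

lemma measurable_nth_gain [measurable]: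
  "u \<in> borel_measurable borel \<Longrightarrow> nth_gain \<rho> u n \<in> borel_measurable borel"
  by (induction n) simp_all

definition total_gain :: "ennreal \<Rightarrow> (real \<Rightarrow> ennreal) \<Rightarrow> real \<Rightarrow> ennreal" where
  "total_gain \<rho> u a = (\<Sum>n. nth_gain \<rho> u n a)"

lemma measurable_total_gain [measurable]:
  "u \<in> borel_measurable borel \<Longrightarrow> total_gain \<rho> u \<in> borel_measurable borel"
  unfolding total_gain_def by measurable

text \<open>Splitting off the first auction shifts the index of all later gains by one; with
  nonnegative terms the series may then be pulled inside \<open>discounted\<close> even if it
  diverges.\<close>

lemma total_gain_eq:
  assumes [measurable]: "u \<in> borel_measurable borel"
  shows "total_gain \<rho> u a =
    discounted (\<lambda>a. u a + (\<rho> * win a * total_gain \<rho> u 0 + lose a * total_gain \<rho> u a)) a"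
proof -
  have "total_gain \<rho> u a = nth_gain \<rho> u 0 a + (\<Sum>n. nth_gain \<rho> u (Suc n) a)"
    unfolding total_gain_def by (subst suminf_offset[where i=1]) auto
  also have "(\<Sum>n. nth_gain \<rho> u (Suc n) a) =
      discounted (\<lambda>a. \<Sum>n. \<rho> * win a * nth_gain \<rho> u n 0 + lose a * nth_gain \<rho> u n a) a"
    by (subst discounted_suminf) auto
  also have "(\<lambda>a. \<Sum>n. \<rho> * win a * nth_gain \<rho> u n 0 + lose a * nth_gain \<rho> u n a) =
      (\<lambda>a. \<rho> * win a * total_gain \<rho> u 0 + lose a * total_gain \<rho> u a)"
    by (simp add: total_gain_def suminf_add[symmetric] summableI ennreal_suminf_cmult fun_eq_iff)
  finally show ?thesis by (simp add: discounted_add)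
qed

text \<open>The total gain is the least solution of its one-step equation.\<close>

lemma total_gain_le:
  assumes [measurable]: "u \<in> borel_measurable borel"
    and F: "\<And>a. discounted (\<lambda>a. u a + (\<rho> * win a * F 0 + lose a * F a)) a \<le> F a"
  shows "total_gain \<rho> u a \<le> F a"
proof -
  have "(\<Sum>i<n. nth_gain \<rho> u i a) \<le> F a" for n a
  proof (induction n arbitrary: a)
    case (Suc n)
    have "(\<Sum>i<Suc n. nth_gain \<rho> u i a) = discounted u a +
        (\<Sum>i<n. discounted (\<lambda>a. \<rho> * win a * nth_gain \<rho> u i 0 + lose a * nth_gain \<rho> u i a) a)"
      by (subst sum.lessThan_Suc_shift) simp
    also have "\<dots> = discounted (\<lambda>a. u a + (\<Sum>i<n. \<rho> * win a * nth_gain \<rho> u i 0 + lose a * nth_gain \<rho> u i a)) a"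
      by (subst discounted_add) (auto simp: discounted_sum)
    also have "\<dots> = discounted (\<lambda>a. u a + (\<rho> * win a * (\<Sum>i<n. nth_gain \<rho> u i 0) + lose a * (\<Sum>i<n. nth_gain \<rho> u i a))) a"
      by (simp add: sum.distrib sum_distrib_left)
    also have "\<dots> \<le> discounted (\<lambda>a. u a + (\<rho> * win a * F 0 + lose a * F a)) a"
      by (intro discounted_mono add_mono mult_left_mono Suc) auto
    also have "\<dots> \<le> F a" by (rule F)
    finally show ?case .
  qed simp
  then show ?thesis unfolding total_gain_def by (intro suminf_le_const summableI)
qed

text \<open>The gains of all wins are those of a game that stops at its first win, when that win is
  additionally rewarded with the value of restarting at age 0.\<close>

lemma total_gain_renewal:
  assumes [measurable]: "u \<in> borel_measurable borel"
  shows "total_gain 1 u a = total_gain 0 (\<lambda>a. u a + win a * total_gain 1 u 0) a"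
proof (rule antisym)
  let ?v = "\<lambda>a. u a + win a * total_gain 1 u 0"
  have le: "total_gain 0 ?v a \<le> total_gain 1 u a" for a
  proof (rule total_gain_le)
    show "discounted (\<lambda>a. ?v a + (0 * win a * total_gain 1 u 0 + lose a * total_gain 1 u a)) a \<le> total_gain 1 u a" for a
      using total_gain_eq[OF assms, of 1 a] by (simp add: add.assoc)
  qed auto
  show "total_gain 0 ?v a \<le> total_gain 1 u a" by (rule le)
  show "total_gain 1 u a \<le> total_gain 0 ?v a"
  proof (rule total_gain_le)
    fix a
    have "discounted (\<lambda>a. u a + (1 * win a * total_gain 0 ?v 0 + lose a * total_gain 0 ?v a)) a
      \<le> discounted (\<lambda>a. ?v a + (0 * win a * total_gain 0 ?v 0 + lose a * total_gain 0 ?v a)) a"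
      using le[of 0] by (intro discounted_mono) (auto simp: add.assoc intro!: add_mono mult_left_mono)
    also have "\<dots> = total_gain 0 ?v a" by (rule total_gain_eq[symmetric]) auto
    finally show "discounted (\<lambda>a. u a + (1 * win a * total_gain 0 ?v 0 + lose a * total_gain 0 ?v a)) a \<le> total_gain 0 ?v a" .
  qed auto
qed

section \<open>Linearity and a priori bounds of the total gain\<close>

lemma nth_gain_add:
  assumes [measurable]: "u \<in> borel_measurable borel" "v \<in> borel_measurable borel"
  shows "nth_gain \<rho> (\<lambda>a. u a + v a) n a = nth_gain \<rho> u n a + nth_gain \<rho> v n a"
proof (induction n arbitrary: a)
  case (Suc n)
  have "nth_gain \<rho> (\<lambda>a. u a + v a) (Suc n) a =
    discounted (\<lambda>a. (\<rho> * win a * nth_gain \<rho> u n 0 + lose a * nth_gain \<rho> u n a) + (\<rho> * win a * nth_gain \<rho> v n 0 + lose a * nth_gain \<rho> v n a)) a"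
    by (simp add: Suc distrib_left ac_simps)
  then show ?case by (subst (asm) discounted_add) auto
qed (simp add: discounted_add)

lemma nth_gain_cmult:
  assumes [measurable]: "u \<in> borel_measurable borel"
  shows "nth_gain \<rho> (\<lambda>a. c * u a) n a = c * nth_gain \<rho> u n a"
proof (induction n arbitrary: a)
  case (Suc n)
  have "nth_gain \<rho> (\<lambda>a. c * u a) (Suc n) a =
    discounted (\<lambda>a. c * (\<rho> * win a * nth_gain \<rho> u n 0 + lose a * nth_gain \<rho> u n a)) a"
    by (simp add: Suc distrib_left ac_simps)
  then show ?case by (subst (asm) discounted_cmult) auto
qed (simp add: discounted_cmult)

lemma total_gain_add:
  assumes [measurable]: "u \<in> borel_measurable borel" "v \<in> borel_measurable borel"
  shows "total_gain \<rho> (\<lambda>a. u a + v a) a = total_gain \<rho> u a + total_gain \<rho> v a"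
  by (simp add: total_gain_def nth_gain_add suminf_add[symmetric] summableI)

lemma total_gain_cmult:
  assumes [measurable]: "u \<in> borel_measurable borel"
  shows "total_gain \<rho> (\<lambda>a. c * u a) a = c * total_gain \<rho> u a"
  by (simp add: total_gain_def nth_gain_cmult ennreal_suminf_cmult)

text \<open>In the renewal identity the reward for restarting is a constant multiple of
  \<open>win\<close>, and linearity pulls the constant out. Kept additive because it is only solved
  for the total gain once finiteness is known; it is used for the surplus, the loss and
  \<open>win\<close> itself.\<close>

lemma total_gain_at_0:
  assumes [measurable]: "u \<in> borel_measurable borel"
  shows "total_gain 1 u 0 = total_gain 0 u 0 + total_gain 1 u 0 * total_gain 0 win 0"
  by (subst total_gain_renewal)
     (simp_all add: total_gain_add total_gain_cmult mult.commute[of "win _"])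

text \<open>Even if the first auction is won, one gap has to elapse before the end; hence the
  constant of \<open>discounted_const\<close> is a supersolution. The bound is below 1, which later
  allows dividing by the probability of no win in time.\<close>

lemma first_win_le: "total_gain 0 win a \<le> ennreal (\<mu> / (\<mu> + \<gamma>))"
proof (rule total_gain_le)
  fix a
  have le1: "ennreal (\<mu> / (\<mu> + \<gamma>)) \<le> 1" using mu_pos gamma_pos by simp
  have "discounted (\<lambda>a. win a + (0 * win a * ennreal (\<mu> / (\<mu> + \<gamma>)) + lose a * ennreal (\<mu> / (\<mu> + \<gamma>)))) a
    \<le> discounted (\<lambda>_. 1) a"
  proof (rule discounted_mono)
    fix a
    have "win a + lose a * ennreal (\<mu> / (\<mu> + \<gamma>)) \<le> win a + lose a * 1"
      by (intro add_mono mult_left_mono le1) auto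
    then show "win a + (0 * win a * ennreal (\<mu> / (\<mu> + \<gamma>)) + lose a * ennreal (\<mu> / (\<mu> + \<gamma>))) \<le> 1"
      by (simp add: win_plus_lose)
  qed
  then show "discounted (\<lambda>a. win a + (0 * win a * ennreal (\<mu> / (\<mu> + \<gamma>)) + lose a * ennreal (\<mu> / (\<mu> + \<gamma>)))) a
    \<le> ennreal (\<mu> / (\<mu> + \<gamma>))" by (simp add: discounted_const)
qed auto

text \<open>The bound is the mean number of auctions before the end. As a supersolution it comes
  from winning every auction, where \<open>c = \<mu> / (\<mu> + \<gamma>) * (1 + c)\<close>.\<close>

lemma total_wins_le: "total_gain 1 win a \<le> ennreal (\<mu> / \<gamma>)"
proof (rule total_gain_le)
  fix a
  have "win a + (1 * win a * c + lose a * c) = 1 * win a + c" for a c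
    using win_plus_lose[of a] by (simp add: add.assoc distrib_right[symmetric])
  then have "discounted (\<lambda>a. win a + (1 * win a * ennreal (\<mu> / \<gamma>) + lose a * ennreal (\<mu> / \<gamma>))) a
    = discounted (\<lambda>a. 1 * win a + ennreal (\<mu> / \<gamma>)) a" by (simp only:)
  also have "\<dots> \<le> discounted (\<lambda>a. 1 + ennreal (\<mu> / \<gamma>)) a"
    by (intro discounted_mono add_right_mono) (metis win_plus_lose le_iff_add mult_1)
  also have "\<dots> = ennreal (\<mu> / (\<mu> + \<gamma>)) * ennreal (1 + \<mu> / \<gamma>)"
    using mu_pos gamma_pos by (simp add: discounted_const)
  also have "\<dots> = ennreal (\<mu> / \<gamma>)"
  proof -
    have "1 + \<mu> / \<gamma> = (\<mu> + \<gamma>) / \<gamma>" using gamma_pos by (simp add: field_simps)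
    then show ?thesis using mu_pos gamma_pos by (simp add: ennreal_mult[symmetric])
  qed
  finally show "discounted (\<lambda>a. win a + (1 * win a * ennreal (\<mu> / \<gamma>) + lose a * ennreal (\<mu> / \<gamma>))) a \<le> ennreal (\<mu> / \<gamma>)" .
qed auto

section \<open>Gains along a realised path and their expectations\<close>

abbreviation age :: "real \<Rightarrow> (nat \<Rightarrow> real \<times> real) \<Rightarrow> nat \<Rightarrow> real" where
  "age a x \<equiv> auction_age b a (arrivals x) (\<lambda>j. snd (x j))"

abbreviation wins :: "real \<Rightarrow> (nat \<Rightarrow> real \<times> real) \<Rightarrow> nat \<Rightarrow> bool" where
  "wins a x \<equiv> won b a (arrivals x) (\<lambda>j. snd (x j))"

text \<open>The Markov property, path by path: after the first auction the ages are those of the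
  shifted path, started at 0 after a win and at the current age otherwise.\<close>

lemma age_case_nat_Suc:
  "age a (case_nat z x) (Suc n) = age (if snd z < b (a + fst z) then 0 else a + fst z) x n"
proof (induction n)
  case (Suc n)
  have "age a (case_nat z x) (Suc (Suc n)) =
    (if snd (x n) < b (age a (case_nat z x) (Suc n)) then 0 else age a (case_nat z x) (Suc n)) + fst (x (Suc n))"
    by (subst auction_age.simps(2)) (simp add: arrivals_Suc del: auction_age.simps(2))
  then show ?case unfolding Suc by (simp add: arrivals_Suc)
qed (simp add: arrivals_Suc)

lemma wins_case_nat_0: "wins a (case_nat z x) 0 \<longleftrightarrow> snd z < b (a + fst z)"
  by (simp add: won_def)

lemma wins_case_nat_Suc:
  "wins a (case_nat z x) (Suc n) = wins (if snd z < b (a + fst z) then 0 else a + fst z) x n"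
  unfolding won_def age_case_nat_Suc by simp

lemma measurable_arrivals [measurable]: "(\<lambda>x. arrivals x n) \<in> borel_measurable path_law"
  unfolding arrivals_def path_law_def by measurable

lemma measurable_nth_price [measurable]: "(\<lambda>x. snd (x n)) \<in> borel_measurable path_law"
  unfolding path_law_def by measurable

lemma measurable_age [measurable]: "(\<lambda>x. age a x n) \<in> borel_measurable path_law"
  by (induction n) simp_all

lemma measurable_wins [measurable]: "Measurable.pred path_law (\<lambda>x. wins a x n)"
  unfolding won_def by measurable

definition mean_gain :: "(real \<Rightarrow> real \<Rightarrow> ennreal) \<Rightarrow> real \<Rightarrow> ennreal" where
  "mean_gain r a = (\<integral>\<^sup>+c. of_bool (c < b a) * r a c \<partial>Q)"

lemma measurable_mean_gain [measurable]:
  assumes [measurable]: "case_prod r \<in> borel_measurable (borel \<Otimes>\<^sub>M borel)"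
  shows "mean_gain r \<in> borel_measurable borel"
  unfolding mean_gain_def by measurable

text \<open>The pathwise counterpart of \<open>nth_gain\<close>, still containing the price:
  \<open>r\<close> is the reward of a win as a function of age and price.\<close>

definition path_gain :: "ennreal \<Rightarrow> (real \<Rightarrow> real \<Rightarrow> ennreal) \<Rightarrow> real \<Rightarrow> (nat \<Rightarrow> real \<times> real) \<Rightarrow> nat \<Rightarrow> ennreal" where
  "path_gain \<rho> r a x n = ennreal (exp (- \<gamma> * arrivals x n)) * (\<Prod>i<n. if wins a x i then \<rho> else 1) *
     (of_bool (wins a x n) * r (age a x n) (snd (x n)))"

lemma measurable_path_gain [measurable]:
  assumes [measurable]: "case_prod r \<in> borel_measurable (borel \<Otimes>\<^sub>M borel)"
  shows "(\<lambda>x. path_gain \<rho> r a x n) \<in> borel_measurable path_law"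
  unfolding path_gain_def by measurable

lemma path_gain_case_nat_0:
  "path_gain \<rho> r a (case_nat z x) 0 =
    ennreal (exp (- \<gamma> * fst z)) * (of_bool (snd z < b (a + fst z)) * r (a + fst z) (snd z))"
  by (simp add: path_gain_def wins_case_nat_0)

lemma path_gain_case_nat_Suc:
  "path_gain \<rho> r a (case_nat z x) (Suc n) =
    (ennreal (exp (- \<gamma> * fst z)) * (if snd z < b (a + fst z) then \<rho> else 1)) *
    path_gain \<rho> r (if snd z < b (a + fst z) then 0 else a + fst z) x n"
proof -
  have "ennreal (exp (- \<gamma> * arrivals (case_nat z x) (Suc n))) =
    ennreal (exp (- \<gamma> * fst z)) * ennreal (exp (- \<gamma> * arrivals x n))"
    by (simp add: arrivals_case_nat_Suc ennreal_mult[symmetric] exp_add[symmetric] algebra_simps)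
  moreover have "(\<Prod>i<Suc n. if wins a (case_nat z x) i then \<rho> else 1) = (if snd z < b (a + fst z) then \<rho> else 1) *
     (\<Prod>i<n. if wins (if snd z < b (a + fst z) then 0 else a + fst z) x i then \<rho> else 1)"
    by (subst prod.lessThan_Suc_shift) (simp only: wins_case_nat_0 wins_case_nat_Suc)
  ultimately show ?thesis
    unfolding path_gain_def wins_case_nat_Suc age_case_nat_Suc nat.case
    by (simp only: ac_simps)
qed

text \<open>Prepending an independent pair to an i.i.d. sequence reproduces its law. The pair is
  integrated with the price inside, because whether the auction is won is decided at an age already
  fixed by the gap.\<close>

lemma nn_integral_path_law_iter:
  assumes [measurable]: "f \<in> borel_measurable path_law"
  shows "(\<integral>\<^sup>+x. f x \<partial>path_law) = (\<integral>\<^sup>+s. \<integral>\<^sup>+c. \<integral>\<^sup>+x. f (case_nat (s, c) x) \<partial>path_law \<partial>Q \<partial>gap_law)"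
proof -
  have f: "f \<in> borel_measurable (PiM UNIV (\<lambda>_. auction_law))"
    using assms by (simp add: path_law_def)
  note [measurable] = f
  have "(\<integral>\<^sup>+x. f x \<partial>path_law) = (\<integral>\<^sup>+x. f x \<partial>distr (auction_law \<Otimes>\<^sub>M path.S) path.S (\<lambda>(z, x). case_nat z x))"
    unfolding path.PiM_iter by (simp add: path_law_def)
  also have "\<dots> = (\<integral>\<^sup>+(z, x). f (case_nat z x) \<partial>(auction_law \<Otimes>\<^sub>M path.S))"
    by (subst nn_integral_distr) (auto simp: split_beta')
  also have "\<dots> = (\<integral>\<^sup>+z. \<integral>\<^sup>+x. f (case_nat z x) \<partial>path.S \<partial>auction_law)"
    by (subst path.nn_integral_fst[symmetric]) auto
  also have "\<dots> = (\<integral>\<^sup>+s. \<integral>\<^sup>+c. \<integral>\<^sup>+x. f (case_nat (s, c) x) \<partial>path.S \<partial>Q \<partial>gap_law)"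
    unfolding auction_law_def
    by (subst Q.nn_integral_fst[symmetric]) (auto simp flip: auction_law_def)
  finally show ?thesis by (simp add: path_law_def)
qed

text \<open>Peeling off the first pair leaves a path of the same law, but started at an age that
  depends on that pair; hence the induction has to range over all ages. Splitting the price integral
  into winning and losing then yields the recursion of \<open>nth_gain\<close>.\<close>

lemma nn_integral_path_gain:
  assumes [measurable]: "case_prod r \<in> borel_measurable (borel \<Otimes>\<^sub>M borel)"
  shows "(\<integral>\<^sup>+x. path_gain \<rho> r a x n \<partial>path_law) = nth_gain \<rho> (mean_gain r) n a"
proof (induction n arbitrary: a)
  case 0
  have "(\<integral>\<^sup>+x. path_gain \<rho> r a x 0 \<partial>path_law) =
    (\<integral>\<^sup>+s. \<integral>\<^sup>+c. ennreal (exp (- \<gamma> * s)) * (of_bool (c < b (a + s)) * r (a + s) c) \<partial>Q \<partial>gap_law)"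
    by (subst nn_integral_path_law_iter) (simp_all only: measurable_path_gain[OF assms] path_gain_case_nat_0 fst_conv snd_conv, simp add: path_law.emeasure_space_1)
  also have "\<dots> = (\<integral>\<^sup>+s. ennreal (exp (- \<gamma> * s)) * mean_gain r (a + s) \<partial>gap_law)"
    unfolding mean_gain_def by (intro nn_integral_cong nn_integral_cmult) auto
  finally show ?case by (simp add: discounted_def)
next
  case (Suc n)
  let ?t = "nth_gain \<rho> (mean_gain r) n"
  have "(\<integral>\<^sup>+x. path_gain \<rho> r a x (Suc n) \<partial>path_law) =
    (\<integral>\<^sup>+s. \<integral>\<^sup>+c. (ennreal (exp (- \<gamma> * s)) * (if c < b (a + s) then \<rho> else 1)) *
       ?t (if c < b (a + s) then 0 else a + s) \<partial>Q \<partial>gap_law)"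
    by (subst nn_integral_path_law_iter)
       (simp_all only: measurable_path_gain[OF assms] path_gain_case_nat_Suc fst_conv snd_conv
          nn_integral_cmult Suc)
  also have "\<dots> = (\<integral>\<^sup>+s. ennreal (exp (- \<gamma> * s)) * (\<rho> * win (a + s) * ?t 0 + lose (a + s) * ?t (a + s)) \<partial>gap_law)"
  proof (intro nn_integral_cong)
    fix s
    have "(\<integral>\<^sup>+c. (ennreal (exp (- \<gamma> * s)) * (if c < b (a + s) then \<rho> else 1)) * ?t (if c < b (a + s) then 0 else a + s) \<partial>Q)
      = (\<integral>\<^sup>+c. ennreal (exp (- \<gamma> * s)) * ((\<rho> * ?t 0) * of_bool (c < b (a + s)) + ?t (a + s) * of_bool (b (a + s) \<le> c)) \<partial>Q)"
      by (intro nn_integral_cong) (auto simp: mult.assoc)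
    also have "\<dots> = ennreal (exp (- \<gamma> * s)) * ((\<rho> * ?t 0) * win (a + s) + ?t (a + s) * lose (a + s))"
      unfolding win_eq lose_eq
      by (subst nn_integral_cmult, measurable, subst nn_integral_add, measurable)
         (simp add: nn_integral_cmult)
    finally show "(\<integral>\<^sup>+c. (ennreal (exp (- \<gamma> * s)) * (if c < b (a + s) then \<rho> else 1)) * ?t (if c < b (a + s) then 0 else a + s) \<partial>Q)
      = ennreal (exp (- \<gamma> * s)) * (\<rho> * win (a + s) * ?t 0 + lose (a + s) * ?t (a + s))"
      by (simp add: ac_simps)
  qed
  finally show ?case by (simp add: discounted_def)
qed

lemma nn_integral_suminf_path_gain:
  assumes [measurable]: "case_prod r \<in> borel_measurable (borel \<Otimes>\<^sub>M borel)"
  shows "(\<integral>\<^sup>+x. (\<Sum>n. path_gain \<rho> r a x n) \<partial>path_law) = total_gain \<rho> (mean_gain r) a"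
  unfolding total_gain_def by (subst nn_integral_suminf) (simp_all add: nn_integral_path_gain)

section \<open>The value as a function of the age\<close>

definition win_prob :: "real \<Rightarrow> real" where "win_prob a = measure Q {..<b a}"

lemma win_eq_win_prob: "win a = ennreal (win_prob a)"
  by (simp add: win_def win_prob_def Q.emeasure_eq_measure)

lemma win_prob_nonneg [simp]: "0 \<le> win_prob a" and win_prob_le_1 [simp]: "win_prob a \<le> 1"
  by (simp_all add: win_prob_def)

lemma lose_eq_win_prob: "lose a = ennreal (1 - win_prob a)"
proof -
  have "ennreal (win_prob a) + lose a = ennreal (win_prob a) + ennreal (1 - win_prob a)"
    using win_plus_lose[of a] by (simp add: win_eq_win_prob ennreal_plus[symmetric] del: ennreal_plus)
  then show ?thesis by (simp add: ennreal_add_left_cancel)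
qed

lemma measurable_win_prob [measurable]: "win_prob \<in> borel_measurable borel"
proof -
  have "win_prob = (\<lambda>a. enn2real (win a))" by (simp add: win_eq_win_prob fun_eq_iff)
  then show ?thesis by simp
qed

text \<open>The accumulated rate at which the growth of the age is interrupted, by the end of the
  sequence or by a win. In the model it coincides with \<open>cumulative_rate\<close>.\<close>

definition hazard :: "real \<Rightarrow> real" where
  "hazard t = (LBINT s:{0..t}. \<gamma> + \<mu> * win_prob s)"

lemma total_gain_eq_tail_integral:
  assumes [measurable]: "u \<in> borel_measurable borel"
  shows "total_gain 1 u a = ennreal (exp ((\<mu> + \<gamma>) * a)) *
    (\<integral>\<^sup>+t\<in>{a..}. ennreal (\<mu> * exp (- (\<mu> + \<gamma>) * t)) * (u t + (win t * total_gain 1 u 0 + lose t * total_gain 1 u t)) \<partial>lborel)"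
  by (subst total_gain_eq, simp, subst discounted_eq_lborel) simp_all

text \<open>In the tail form a later age only shrinks the domain of integration and changes the
  finite factor in front.\<close>

lemma total_gain_finite:
  assumes [measurable]: "u \<in> borel_measurable borel"
    and fin: "total_gain 1 u 0 < \<top>" and a: "0 \<le> a"
  shows "total_gain 1 u a < \<top>"
proof -
  let ?G = "\<lambda>t. ennreal (\<mu> * exp (- (\<mu> + \<gamma>) * t)) * (u t + (win t * total_gain 1 u 0 + lose t * total_gain 1 u t))"
  have "(\<integral>\<^sup>+t\<in>{a..}. ?G t \<partial>lborel) \<le> (\<integral>\<^sup>+t\<in>{0..}. ?G t \<partial>lborel)"
    using a by (intro nn_integral_mono) (auto simp: indicator_def)
  also have "\<dots> < \<top>" using fin total_gain_eq_tail_integral[of u 0] by simp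
  finally show ?thesis
    by (subst total_gain_eq_tail_integral) (auto simp: ennreal_mult_less_top)
qed

lemma total_gain_ode:
  fixes u :: "real \<Rightarrow> ennreal"
  defines "R \<equiv> \<lambda>a. enn2real (total_gain 1 u a)"
  assumes u [measurable]: "u \<in> borel_measurable borel" and u_fin: "\<And>a. u a < \<top>"
    and fin: "total_gain 1 u 0 < \<top>" and a: "0 \<le> a"
  shows "set_integrable lborel {0..a} (\<lambda>t. exp (- hazard t) * \<mu> * (enn2real (u t) + win_prob t * R 0))" (is ?int)
    and "R a = exp (hazard a) *
      (R 0 - (LBINT t:{0..a}. exp (- hazard t) * \<mu> * (enn2real (u t) + win_prob t * R 0)))" (is ?eq)
proof -
  define G where "G = (\<lambda>t. ennreal (\<mu> * exp (- (\<mu> + \<gamma>) * t)) * (u t + (win t * total_gain 1 u 0 + lose t * total_gain 1 u t)))"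
  have [measurable]: "G \<in> borel_measurable borel" unfolding G_def by measurable
  have [measurable]: "R \<in> borel_measurable borel" unfolding R_def by measurable
  define I where "I = (\<lambda>a. \<integral>\<^sup>+t\<in>{a..}. G t \<partial>lborel)"
  \<comment> \<open>The exponential cancels the factor in front of the tail integral, so
    \<open>y\<close> is the tail integral itself and only its increments over finite intervals
    matter. The constant \<open>R 0\<close> is counted among the data in \<open>f\<close>, which
    leaves an equation linear in \<open>y\<close> with coefficient \<open>p\<close>.\<close>
  define y where "y = (\<lambda>t. exp (- (\<mu> + \<gamma>) * t) * R t)"
  define f where "f = (\<lambda>t. \<mu> * exp (- (\<mu> + \<gamma>) * t) * (enn2real (u t) + win_prob t * R 0))"
  define p where "p = (\<lambda>t. \<mu> * (1 - win_prob t))"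
  have [measurable]: "y \<in> borel_measurable borel" "f \<in> borel_measurable borel" "p \<in> borel_measurable borel"
    unfolding y_def f_def p_def by measurable
  have totalI: "total_gain 1 u t = ennreal (exp ((\<mu> + \<gamma>) * t)) * I t" for t
    unfolding I_def G_def by (rule total_gain_eq_tail_integral) fact
  have total_fin: "total_gain 1 u t < \<top>" if "0 \<le> t" for t
    using total_gain_finite[OF u fin that] .
  have R0: "0 \<le> R t" for t by (simp add: R_def)
  have p0: "0 \<le> p t" "p t \<le> \<mu>" for t using mu_pos
    by (auto simp: p_def mult_le_cancel_left1)
  have y0: "0 \<le> y t" for t using R0 by (simp add: y_def)
  have f0: "0 \<le> f t" for t using R0 mu_pos by (simp add: f_def)
  have yI: "y t = enn2real (I t)" for t
    by (simp add: y_def R_def totalI enn2real_mult flip: exp_add mult.assoc) (simp add: algebra_simps)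
  have Ifin: "I t < \<top>" if "0 \<le> t" for t
  proof -
    have "I t \<noteq> \<top>" using total_fin[OF that] totalI[of t] by (auto simp: ennreal_mult_top)
    then show ?thesis by (simp add: top.not_eq_extremum)
  qed
  have Gh: "G t = ennreal (f t + p t * y t)" if "0 \<le> t" for t
  proof -
    have "u t = ennreal (enn2real (u t))" using u_fin by simp
    moreover have "total_gain 1 u 0 = ennreal (R 0)" "total_gain 1 u t = ennreal (R t)"
      using total_fin[of 0] total_fin[OF that] by (simp_all add: R_def)
    ultimately have "G t = ennreal (\<mu> * exp (- (\<mu> + \<gamma>) * t)) * (ennreal (enn2real (u t)) + (ennreal (win_prob t) * ennreal (R 0) + ennreal (1 - win_prob t) * ennreal (R t)))"
      unfolding G_def win_eq_win_prob lose_eq_win_prob by simp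
    also have "\<dots> = ennreal (\<mu> * exp (- (\<mu> + \<gamma>) * t) * (enn2real (u t) + (win_prob t * R 0 + (1 - win_prob t) * R t)))"
      using R0 mu_pos by (simp add: ennreal_mult[symmetric] ennreal_plus[symmetric] del: ennreal_plus)
    also have "\<mu> * exp (- (\<mu> + \<gamma>) * t) * (enn2real (u t) + (win_prob t * R 0 + (1 - win_prob t) * R t)) = f t + p t * y t"
      by (simp add: f_def p_def y_def algebra_simps)
    finally show ?thesis .
  qed
  \<comment> \<open>The point \<open>v\<close> is put into both pieces, so that the first one is an
    integral over a closed interval and the second one is \<open>I v\<close>; being a null set, it
    does no harm. The identity is additive because subtraction has to wait for the finiteness of
    \<open>I 0\<close>.\<close>
  have split: "I 0 = (\<integral>\<^sup>+t. ennreal (indicator {0..v} t * (f t + p t * y t)) \<partial>lborel) + I v" if "0 \<le> v" for v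
  proof -
    have "I 0 = (\<integral>\<^sup>+t. (G t * indicator {0..v} t + G t * indicator {v<..} t) \<partial>lborel)"
      unfolding I_def using that by (intro nn_integral_cong) (auto simp: indicator_def)
    also have "\<dots> = (\<integral>\<^sup>+t. G t * indicator {0..v} t \<partial>lborel) + (\<integral>\<^sup>+t. G t * indicator {v<..} t \<partial>lborel)"
      by (rule nn_integral_add) auto
    also have "(\<integral>\<^sup>+t. G t * indicator {v<..} t \<partial>lborel) = I v"
      unfolding I_def
      by (intro nn_integral_cong_AE) (use AE_lborel_singleton[of v] in \<open>eventually_elim, auto simp: indicator_def\<close>)
    also have "(\<integral>\<^sup>+t. G t * indicator {0..v} t \<partial>lborel) = (\<integral>\<^sup>+t. ennreal (indicator {0..v} t * (f t + p t * y t)) \<partial>lborel)"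
      by (intro nn_integral_cong) (auto simp: indicator_def Gh)
    finally show ?thesis .
  qed
  have h_int: "set_integrable lborel {0..v} (\<lambda>t. f t + p t * y t)" if "0 \<le> v" for v
    unfolding set_integrable_def
  proof (intro integrableI_nonneg)
    have "(\<integral>\<^sup>+t. ennreal (indicator {0..v} t * (f t + p t * y t)) \<partial>lborel) \<le> I 0"
      using split[OF that] by simp
    then show "(\<integral>\<^sup>+t. ennreal (indicator {0..v} t *\<^sub>R (f t + p t * y t)) \<partial>lborel) < \<infinity>"
      using Ifin[of 0] by (simp add: order.strict_trans1)
  qed (use f0 p0 y0 in auto)
  have eq: "y v = y 0 - (LBINT t:{0..v}. f t + p t * y t)" if "0 \<le> v" for v
  proof -
    have "(LBINT t:{0..v}. f t + p t * y t) = enn2real (\<integral>\<^sup>+t. ennreal (indicator {0..v} t * (f t + p t * y t)) \<partial>lborel)"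
      unfolding set_lebesgue_integral_def using f0 p0 y0
      by (subst integral_eq_nn_integral) auto
    moreover have "(\<integral>\<^sup>+t. ennreal (indicator {0..v} t * (f t + p t * y t)) \<partial>lborel) < \<top>"
      using split[OF that] Ifin[of 0] by (auto simp: order.strict_trans1)
    ultimately show ?thesis
      using arg_cong[OF split[OF that], of enn2real] Ifin[OF that] by (simp add: yI enn2real_plus)
  qed
  have f_int: "set_integrable lborel {0..v} f" if "0 \<le> v" for v
    by (rule set_integrable_bound[OF h_int[OF that]])
       (use f0 p0 y0 in \<open>auto simp: set_borel_measurable_def intro!: AE_I2\<close>)
  have py_int: "set_integrable lborel {0..v} (\<lambda>t. p t * y t)" if "0 \<le> v" for v
    by (rule set_integrable_bound[OF h_int[OF that]])
       (use f0 p0 y0 in \<open>auto simp: set_borel_measurable_def intro!: AE_I2\<close>)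
  have const_int: "set_integrable lborel {0..v} (\<lambda>_. c)" for v c :: real
    by (cases "0 \<le> v") (auto simp: set_integrable_def)
  have p_int: "set_integrable lborel {0..v} p" for v
    by (rule set_integrable_bound[OF const_int[of v \<mu>]])
       (use p0 mu_pos in \<open>auto simp: set_borel_measurable_def intro!: AE_I2\<close>)
  define B where "B = (\<lambda>t. LBINT s:{0..t}. p s)"
  have B_integral: "B t = integral {0..t} p" for t
    unfolding B_def by (rule set_borel_integral_eq_integral(2)[OF p_int])
  \<comment> \<open>The integrating factor \<open>exp (B t)\<close> and the weight with rate \<mu> +
    \<gamma> combine to \<open>exp (- hazard t)\<close>, since
    \<open>(\<mu> + \<gamma>) - \<mu> * (1 - win_prob s)\<close> is
    \<open>\<gamma> + \<mu> * win_prob s\<close>.\<close>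
  have hazard: "hazard t = (\<mu> + \<gamma>) * t - B t" if "0 \<le> t" for t
  proof -
    have "hazard t = (LBINT s:{0..t}. (\<mu> + \<gamma>) - p s)"
      by (simp add: hazard_def p_def algebra_simps)
    also have "\<dots> = (LBINT s:{0..t}. (\<mu> + \<gamma>)) - B t"
      unfolding B_def by (rule set_integral_diff(2)[OF const_int p_int])
    also have "(LBINT s:{0..t}. (\<mu> + \<gamma>)) = (\<mu> + \<gamma>) * t"
      using that by (simp add: set_lebesgue_integral_def)
    finally show ?thesis .
  qed
  have B_le: "\<bar>B t\<bar> \<le> \<mu> * t" if "0 \<le> t" for t
  proof -
    have "B t \<le> (LBINT s:{0..t}. \<mu>)" unfolding B_def
      by (rule set_integral_mono[OF p_int const_int]) (use p0 in auto)
    moreover have "0 \<le> B t" unfolding B_def set_lebesgue_integral_def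
      using p0 by (intro Bochner_Integration.integral_nonneg) auto
    ultimately show ?thesis using that by (simp add: set_lebesgue_integral_def mult.commute)
  qed
  have [measurable]: "B \<in> borel_measurable borel"
  proof -
    \<comment> \<open>With \<open>t\<close> moved from the domain into the integrand, this is an
      integral with a parameter of a jointly measurable function.\<close>
    have "B = (\<lambda>t. LBINT s. (if 0 \<le> s \<and> s \<le> t then p s else 0))"
      by (auto simp: fun_eq_iff B_def set_lebesgue_integral_def indicator_def intro!: Bochner_Integration.integral_cong)
    then show ?thesis by simp
  qed
  have Bf_int: "set_integrable lborel {0..a} (\<lambda>t. exp (B t) * f t)"
  proof (rule set_integrable_bound)
    show "set_integrable lborel {0..a} (\<lambda>t. exp (\<mu> * a) * f t)"
      by (rule set_integrable_mult_right) (use f_int[OF a] in auto)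
    have "exp (B t) * f t \<le> exp (\<mu> * a) * f t" if "0 \<le> t" "t \<le> a" for t
    proof -
      have "B t \<le> \<mu> * a" using B_le[OF that(1)] mu_pos that
        by (smt (verit) mult_left_mono)
      then show ?thesis using f0 by (intro mult_right_mono) auto
    qed
    then show "AE t\<in>{0..a} in lborel. norm (exp (B t) * f t) \<le> norm (exp (\<mu> * a) * f t)"
      using f0 by (auto intro!: AE_I2 simp: abs_mult)
  qed (auto simp: set_borel_measurable_def)
  have yB: "y a * exp (B a) = y 0 - integral {0..a} (\<lambda>t. exp (B t) * f t)"
    unfolding B_integral
  proof (rule linear_integral_equation[where m=\<mu>])
    show "y v = y 0 - integral {0..v} (\<lambda>u. f u + p u * y u)" if "0 \<le> v" "v \<le> a" for v
      using eq[OF that(1)] by (simp add: set_borel_integral_eq_integral(2)[OF h_int[OF that(1)]])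
    show "(\<lambda>u. exp (integral {0..u} p) * f u) integrable_on {0..a}"
      using set_borel_integral_eq_integral(1)[OF Bf_int] by (simp add: B_integral)
  qed (use a p0 f0 y0 set_borel_integral_eq_integral(1)[OF p_int] set_borel_integral_eq_integral(1)[OF f_int[OF a]]
      set_borel_integral_eq_integral(1)[OF py_int[OF a]] in auto)
  have Bf: "exp (B t) * f t = exp (- hazard t) * \<mu> * (enn2real (u t) + win_prob t * R 0)" if "0 \<le> t" for t
    using that by (simp add: f_def hazard exp_diff exp_minus exp_add field_simps)
  have cong: "set_integrable lborel {0..a} (\<lambda>t. exp (B t) * f t) = ?int"
    by (rule set_integrable_cong) (auto simp: Bf)
  then show ?int using Bf_int by simp
  have "integral {0..a} (\<lambda>t. exp (B t) * f t) = (LBINT t:{0..a}. exp (B t) * f t)"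
    using set_borel_integral_eq_integral(2)[OF Bf_int] by simp
  also have "\<dots> = (LBINT t:{0..a}. exp (- hazard t) * \<mu> * (enn2real (u t) + win_prob t * R 0))"
    by (rule set_lebesgue_integral_cong) (auto simp: Bf)
  finally have "y a * exp (B a) = R 0 - (LBINT t:{0..a}. exp (- hazard t) * \<mu> * (enn2real (u t) + win_prob t * R 0))"
    using yB by (simp add: y_def)
  moreover have "y a * exp (B a) = exp (- hazard a) * R a"
    using a by (simp add: y_def hazard exp_diff exp_minus exp_add field_simps)
  ultimately show ?eq by (simp add: exp_minus field_simps)
qed

lemma nth_gain_mono: "(\<And>a. u a \<le> v a) \<Longrightarrow> nth_gain \<rho> u n a \<le> nth_gain \<rho> v n a"
  by (induction n arbitrary: a) (auto intro!: discounted_mono add_mono mult_left_mono)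

lemma total_gain_mono: "(\<And>a. u a \<le> v a) \<Longrightarrow> total_gain \<rho> u a \<le> total_gain \<rho> v a"
  unfolding total_gain_def by (intro suminf_le nth_gain_mono summableI) auto

lemma total_gain_first_le:
  assumes [measurable]: "u \<in> borel_measurable borel"
  shows "total_gain 0 u a \<le> total_gain 1 u a"
  by (subst total_gain_renewal, simp, rule total_gain_mono) simp

lemma age_before_first_win: "\<forall>i<n. \<not> wins a x i \<Longrightarrow> age a x n = a + arrivals x n"
  by (induction n) (simp_all add: won_def arrivals_Suc less_Suc_eq all_conj_distrib)

lemma path_gain_0:
  "path_gain 0 r a x n = ennreal (exp (- \<gamma> * arrivals x n)) *
     (of_bool (wins a x n \<and> (\<forall>i<n. \<not> wins a x i)) * r (age a x n) (snd (x n)))"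
proof -
  have "(\<Prod>i<n. if wins a x i then 0 else 1 :: ennreal) = of_bool (\<forall>i<n. \<not> wins a x i)"
    by (induction n) (auto simp: less_Suc_eq)
  then show ?thesis by (simp add: path_gain_def)
qed

lemma path_gain_1:
  "path_gain 1 r a x n = ennreal (exp (- \<gamma> * arrivals x n)) * (of_bool (wins a x n) * r (age a x n) (snd (x n)))"
  by (simp add: path_gain_def)

lemma mean_gain_age_only: "mean_gain (\<lambda>a _. h a) a = win a * h a"
  by (simp add: mean_gain_def win_eq nn_integral_multc)

end

section \<open>Prices, series and independence\<close>

text \<open>For a price \<open>c\<close> between 0 and \<open>\<beta>\<close> the excess is the
  length of \<open>{c..\<beta>}\<close>; exchanging the integrals turns the event that
  \<open>t\<close> lies above the price into the distribution function. Higher prices contribute 0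
  because \<open>ennreal\<close> cuts off negative numbers.\<close>

lemma (in real_distribution) nn_integral_excess:
  assumes nonneg: "AE c in M. 0 \<le> c" and \<beta>: "0 \<le> \<beta>"
  shows "(\<integral>\<^sup>+c. ennreal (\<beta> - c) \<partial>M) = ennreal (LBINT t:{0..\<beta>}. cdf M t)"
proof -
  have [measurable]: "cdf M \<in> borel_measurable borel"
    by (intro borel_measurable_mono monoI cdf_nondecreasing)
  have cdf_eq: "(\<integral>\<^sup>+c. of_bool (c \<le> t) \<partial>M) = ennreal (cdf M t)" for t
  proof -
    have "(\<integral>\<^sup>+c. of_bool (c \<le> t) \<partial>M) = (\<integral>\<^sup>+c. indicator {..t} c \<partial>M)"
      by (intro nn_integral_cong) (auto simp: indicator_def)
    then show ?thesis by (simp add: cdf_def emeasure_eq_measure)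
  qed
  have "(\<integral>\<^sup>+c. ennreal (\<beta> - c) \<partial>M) = (\<integral>\<^sup>+c. (\<integral>\<^sup>+t. indicator {0..\<beta>} t * of_bool (c \<le> t) \<partial>lborel) \<partial>M)"
  proof (intro nn_integral_cong_AE, use nonneg in eventually_elim)
    case (elim c)
    have "(\<integral>\<^sup>+t. indicator {0..\<beta>} t * of_bool (c \<le> t) \<partial>lborel) = (\<integral>\<^sup>+t. indicator {c..\<beta>} t \<partial>lborel)"
      using elim by (intro nn_integral_cong) (auto simp: indicator_def)
    then show ?case by (cases "c \<le> \<beta>") (auto simp: ennreal_neg)
  qed
  also have "\<dots> = (\<integral>\<^sup>+t. (\<integral>\<^sup>+c. indicator {0..\<beta>} t * of_bool (c \<le> t) \<partial>M) \<partial>lborel)"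
  proof -
    interpret pair_sigma_finite M lborel ..
    show ?thesis by (rule Fubini'[symmetric]) measurable
  qed
  also have "\<dots> = (\<integral>\<^sup>+t. ennreal (indicator {0..\<beta>} t * cdf M t) \<partial>lborel)"
    by (intro nn_integral_cong)
       (auto simp: nn_integral_cmult cdf_eq ennreal_mult'' cdf_nonneg ennreal_indicator split: split_indicator)
  also have "\<dots> = ennreal (\<integral>t. indicator {0..\<beta>} t * cdf M t \<partial>lborel)"
  proof (rule nn_integral_eq_integral)
    have "integrable lborel (\<lambda>t. indicator {0..\<beta>} t :: real)"
      using \<beta> by simp
    then show "integrable lborel (\<lambda>t. indicator {0..\<beta>} t * cdf M t)"
      by (rule Bochner_Integration.integrable_bound)
         (auto simp: abs_mult cdf_nonneg cdf_bounded_prob indicator_def)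
  qed (auto simp: cdf_nonneg)
  finally show ?thesis by (simp add: set_lebesgue_integral_def)
qed

text \<open>On a win, \<open>\<kappa> - c\<close> is
  \<open>(\<kappa> - \<beta>) + (\<beta> - c)\<close>: the first summand contributes
  \<open>\<kappa> - \<beta>\<close> times the winning probability, the second one the excess
  integral. Winning is strict whereas the distribution function is not, hence
  \<open>no_atom\<close>. Integrability holds for any mean price, since a won price lies between 0
  and \<open>\<beta>\<close>.\<close>

lemma (in real_distribution) utility_eq:
  fixes \<kappa> \<beta> :: real
  assumes nonneg: "AE c in M. 0 \<le> c" and \<beta>: "0 \<le> \<beta>"
    and no_atom: "measure M {..<\<beta>} = cdf M \<beta>"
  shows "(\<integral>\<^sup>+c. of_bool (c < \<beta>) * ennreal (\<kappa> - c) \<partial>M) < \<top>" (is "?P < _")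
    and "(\<integral>\<^sup>+c. of_bool (c < \<beta>) * ennreal (c - \<kappa>) \<partial>M) < \<top>" (is "?N < _")
    and "enn2real (\<integral>\<^sup>+c. of_bool (c < \<beta>) * ennreal (\<kappa> - c) \<partial>M) -
      enn2real (\<integral>\<^sup>+c. of_bool (c < \<beta>) * ennreal (c - \<kappa>) \<partial>M) = utility (cdf M) \<kappa> \<beta>"
proof -
  define f where "f = (\<lambda>c. of_bool (c < \<beta>) * (\<kappa> - c))"
  have [measurable]: "f \<in> borel_measurable M" unfolding f_def by measurable
  have int: "integrable M f"
  proof (rule integrable_const_bound[of _ "\<bar>\<kappa>\<bar> + \<beta>"])
    show "AE c in M. norm (f c) \<le> \<bar>\<kappa>\<bar> + \<beta>"
      using nonneg by eventually_elim (use \<beta> in \<open>auto simp: f_def\<close>)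
  qed simp
  have P: "?P = (\<integral>\<^sup>+c. ennreal (f c) \<partial>M)" and N: "?N = (\<integral>\<^sup>+c. ennreal (- f c) \<partial>M)"
    by (auto simp: f_def intro!: nn_integral_cong)
  from int show "?P < \<top>" "?N < \<top>"
    unfolding P N by (auto simp: real_integrable_def top.not_eq_extremum)
  have 1: "integrable M (\<lambda>c. (\<kappa> - \<beta>) * indicator {..<\<beta>} c)" by (auto simp: integrable_indicator_iff emeasure_eq_measure)
  have eq: "f c = (\<kappa> - \<beta>) * indicator {..<\<beta>} c + max 0 (\<beta> - c)" for c
    by (auto simp: f_def indicator_def)
  have 2: "integrable M (\<lambda>c. max 0 (\<beta> - c))"
    using Bochner_Integration.integrable_diff[OF int 1] by (simp add: eq)
  have "(\<integral>c. max 0 (\<beta> - c) \<partial>M) = enn2real (\<integral>\<^sup>+c. ennreal (\<beta> - c) \<partial>M)"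
    by (subst integral_eq_nn_integral) (auto simp: ennreal_max_0 max.commute)
  also have "\<dots> = (LBINT t:{0..\<beta>}. cdf M t)"
    by (subst nn_integral_excess[OF nonneg \<beta>])
       (auto simp: set_lebesgue_integral_def cdf_nonneg intro!: enn2real_ennreal Bochner_Integration.integral_nonneg)
  finally have "(\<integral>c. f c \<partial>M) = (\<kappa> - \<beta>) * cdf M \<beta> + (LBINT t:{0..\<beta>}. cdf M t)"
    unfolding eq using 1 2 by (subst Bochner_Integration.integral_add) (auto simp: no_atom)
  then show "enn2real ?P - enn2real ?N = utility (cdf M) \<kappa> \<beta>"
    unfolding P N using real_lebesgue_integral_def[OF int]
    by (simp add: utility_def payment_def algebra_simps)
qed

section \<open>Signed series through their positive and negative parts\<close>

lemma ennreal_abs_eq: "ennreal \<bar>x\<bar> = ennreal x + ennreal (- x)"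
  by (cases "0 \<le> x") (auto simp: ennreal_neg)

lemma real_eq_enn2real_diff: "x = enn2real (ennreal x) - enn2real (ennreal (- x))"
  by (cases "0 \<le> x") (auto simp: ennreal_neg)

text \<open>Finite sums of both parts make the two nonnegative real series summable, so the real
  series converges and \<open>suminf\<close> does not fall back to an arbitrary value.\<close>

lemma suminf_eq_enn2real_diff:
  fixes f :: "nat \<Rightarrow> real"
  assumes "(\<Sum>i. ennreal (f i)) < \<top>" "(\<Sum>i. ennreal (- f i)) < \<top>"
  shows "(\<Sum>i. f i) = enn2real (\<Sum>i. ennreal (f i)) - enn2real (\<Sum>i. ennreal (- f i))"
proof -
  have *: "summable (\<lambda>i. max 0 (g i))" "(\<Sum>i. max 0 (g i)) = enn2real (\<Sum>i. ennreal (g i))"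
    if "(\<Sum>i. ennreal (g i)) < \<top>" for g :: "nat \<Rightarrow> real"
  proof -
    have eq: "(\<Sum>i. ennreal (max 0 (g i))) = (\<Sum>i. ennreal (g i))" by (simp add: ennreal_max_0)
    show s: "summable (\<lambda>i. max 0 (g i))"
      using that eq by (intro summable_suminf_not_top) auto
    have "(\<Sum>i. ennreal (max 0 (g i))) = ennreal (\<Sum>i. max 0 (g i))"
      using that eq by (intro suminf_ennreal) auto
    then show "(\<Sum>i. max 0 (g i)) = enn2real (\<Sum>i. ennreal (g i))"
      using eq suminf_nonneg[OF s] by (metis enn2real_ennreal max.cobounded1)
  qed
  have "(\<Sum>i. f i) = (\<Sum>i. max 0 (f i) - max 0 (- f i))"
    by (intro arg_cong[of _ _ suminf]) (auto simp: fun_eq_iff)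
  also have "\<dots> = (\<Sum>i. max 0 (f i)) - (\<Sum>i. max 0 (- f i))"
    by (intro suminf_diff[symmetric] * assms)
  finally show ?thesis using *(2)[OF assms(1)] *(2)[OF assms(2)] by simp
qed

lemma integral_enn2real:
  assumes [measurable]: "f \<in> borel_measurable M" and fin: "(\<integral>\<^sup>+x. f x \<partial>M) < \<top>"
  shows "integrable M (\<lambda>x. enn2real (f x))" and "(\<integral>x. enn2real (f x) \<partial>M) = enn2real (\<integral>\<^sup>+x. f x \<partial>M)"
proof -
  have "AE x in M. f x \<noteq> \<infinity>" using fin by (intro nn_integral_PInf_AE) auto
  then have eq: "(\<integral>\<^sup>+x. ennreal (enn2real (f x)) \<partial>M) = (\<integral>\<^sup>+x. f x \<partial>M)"
    by (intro nn_integral_cong_AE, eventually_elim) (simp add: top.not_eq_extremum)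
  show "integrable M (\<lambda>x. enn2real (f x))" using eq fin by (intro integrableI_nonneg) auto
  show "(\<integral>x. enn2real (f x) \<partial>M) = enn2real (\<integral>\<^sup>+x. f x \<partial>M)"
    using eq by (subst integral_eq_nn_integral) auto
qed

lemma integral_suminf_eq_enn2real_diff:
  fixes f :: "nat \<Rightarrow> 'a \<Rightarrow> real"
  assumes [measurable]: "\<And>i. f i \<in> borel_measurable M"
    and fin: "(\<integral>\<^sup>+x. (\<Sum>i. ennreal (f i x)) \<partial>M) < \<top>" "(\<integral>\<^sup>+x. (\<Sum>i. ennreal (- f i x)) \<partial>M) < \<top>"
  shows "(\<integral>x. (\<Sum>i. f i x) \<partial>M) =
    enn2real (\<integral>\<^sup>+x. (\<Sum>i. ennreal (f i x)) \<partial>M) - enn2real (\<integral>\<^sup>+x. (\<Sum>i. ennreal (- f i x)) \<partial>M)"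
proof -
  have "AE x in M. (\<Sum>i. ennreal (f i x)) \<noteq> \<infinity>" "AE x in M. (\<Sum>i. ennreal (- f i x)) \<noteq> \<infinity>"
    using fin by (intro nn_integral_PInf_AE; auto)+
  then have "AE x in M. (\<Sum>i. f i x) = enn2real (\<Sum>i. ennreal (f i x)) - enn2real (\<Sum>i. ennreal (- f i x))"
    by eventually_elim (auto intro!: suminf_eq_enn2real_diff simp: top.not_eq_extremum)
  then have "(\<integral>x. (\<Sum>i. f i x) \<partial>M) =
      (\<integral>x. enn2real (\<Sum>i. ennreal (f i x)) - enn2real (\<Sum>i. ennreal (- f i x)) \<partial>M)"
    by (intro integral_cong_AE) auto
  then show ?thesis
    using integral_enn2real[OF _ fin(1)] integral_enn2real[OF _ fin(2)] by simp
qed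

text \<open>Holds for infinite \<open>S\<close> as well, where both sides are 0.\<close>

lemma real_card_eq_enn2real_suminf: "real (card S) = enn2real (\<Sum>i. of_bool (i \<in> S))" for S :: "nat set"
proof -
  have "(\<Sum>i. of_bool (i \<in> S) :: ennreal) = (\<Sum>i. indicator S i)"
    by (intro arg_cong[of _ _ suminf]) (auto simp: indicator_def)
  also have "\<dots> = emeasure (count_space UNIV) S"
    by (simp add: nn_integral_count_space_nat[symmetric])
  finally show ?thesis
    by (cases "finite S") (simp_all add: emeasure_count_space_finite emeasure_count_space_infinite ennreal_of_nat_eq_real_of_nat)
qed

text \<open>Both versions occur: \<open>number_won\<close> admits a win at the very end, whereas the
  conditioning event asks for a first win strictly before it. The maximum covers negative
  \<open>a\<close>, where the tail has mass 1.\<close>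

lemma emeasure_exponential_tail:
  assumes "0 < l"
  shows "(\<integral>\<^sup>+s. of_bool (a \<le> s) \<partial>density lborel (exponential_density l)) = ennreal (exp (- l * max 0 a))" (is ?le)
    and "(\<integral>\<^sup>+s. of_bool (a < s) \<partial>density lborel (exponential_density l)) = ennreal (exp (- l * max 0 a))" (is ?lt)
proof -
  let ?H = "density lborel (exponential_density l)"
  interpret H: prob_space ?H using assms by (rule prob_space_exponential_density)
  have sp: "space ?H - {..a} = {a<..}" by auto
  have "(\<integral>\<^sup>+s. of_bool (a < s) \<partial>?H) = (\<integral>\<^sup>+s. indicator {a<..} s \<partial>?H)"
    by (intro nn_integral_cong) (auto simp: indicator_def)
  also have "\<dots> = emeasure ?H {a<..}" by simp
  also have "\<dots> = 1 - emeasure ?H {..a}"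
    using emeasure_compl[of "{..a}" ?H] H.emeasure_space_1 sp by simp
  also have "\<dots> = 1 - ennreal (if 0 \<le> a then 1 - exp (- l * a) else 0)"
    using assms by (simp add: emeasure_erlang_density erlang_CDF_0)
  also have "\<dots> = ennreal (exp (- l * max 0 a))"
    using assms by (auto simp: ennreal_minus ennreal_1[symmetric] simp del: ennreal_1)
  finally show ?lt .
  have "AE s in ?H. s \<noteq> a"
    by (subst AE_density) (use AE_lborel_singleton[of a] in auto)
  then have "(\<integral>\<^sup>+s. of_bool (a \<le> s) \<partial>?H) = (\<integral>\<^sup>+s. of_bool (a < s) \<partial>?H)"
    by (intro nn_integral_cong_AE, eventually_elim) auto
  then show ?le using \<open>?lt\<close> by simp
qed

text \<open>The independent family is grouped twice: into the blocks
  \<open>{Gap i, Price i}\<close>, which makes the pairs i.i.d., and into all gaps and prices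
  against \<open>End\<close>, which makes the whole path independent of the end.\<close>

lemma (in prob_space) distr_sources:
  assumes indep: "indep_vars (\<lambda>_. borel) (sources T C S) UNIV"
    and G: "\<And>i. distr M borel (interarrival T i) = G"
    and Q: "\<And>i. distr M borel (C i) = Q"
  shows "distr M (PiM UNIV (\<lambda>_::nat. borel \<Otimes>\<^sub>M borel) \<Otimes>\<^sub>M borel) (\<lambda>\<omega>. (\<lambda>i. (interarrival T i \<omega>, C i \<omega>), S \<omega>)) =
    PiM UNIV (\<lambda>_::nat. G \<Otimes>\<^sub>M Q) \<Otimes>\<^sub>M distr M borel S"
proof -
  let ?X = "sources T C S"
  have rv: "random_variable borel (?X s)" for s using indep by (auto simp: indep_vars_def)
  have [measurable]: "random_variable borel (interarrival T i)" "random_variable borel (C i)" "random_variable borel S" for i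
    using rv[of "Gap i"] rv[of "Price i"] rv[of End] by (auto simp: sources_def)
  let ?Y = "\<lambda>i \<omega>. (interarrival T i \<omega>, C i \<omega>)"
  have "indep_vars (\<lambda>i. PiM {Gap i, Price i} (\<lambda>_. borel)) (\<lambda>i \<omega>. restrict (\<lambda>s. ?X s \<omega>) {Gap i, Price i}) UNIV"
    by (rule indep_vars_restrict[OF indep]) (auto simp: disjoint_family_on_def)
  then have "indep_vars (\<lambda>_. borel \<Otimes>\<^sub>M borel) (\<lambda>i \<omega>. (\<lambda>f. (f (Gap i), f (Price i))) (restrict (\<lambda>s. ?X s \<omega>) {Gap i, Price i})) UNIV"
    by (rule indep_vars_compose2) measurable
  then have "indep_vars (\<lambda>_. borel \<Otimes>\<^sub>M borel) ?Y UNIV" by (simp add: sources_def)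
  then have "distr M (PiM UNIV (\<lambda>_::nat. borel \<Otimes>\<^sub>M borel)) (\<lambda>\<omega>. \<lambda>i\<in>UNIV. ?Y i \<omega>) =
      PiM UNIV (\<lambda>i. distr M (borel \<Otimes>\<^sub>M borel) (?Y i))"
    by (subst (asm) indep_vars_iff_distr_eq_PiM) auto
  moreover have "distr M (borel \<Otimes>\<^sub>M borel) (?Y i) = G \<Otimes>\<^sub>M Q" for i
  proof -
    have "indep_var (PiM {Gap i} (\<lambda>_. borel)) (\<lambda>\<omega>. restrict (\<lambda>s. ?X s \<omega>) {Gap i}) (PiM {Price i} (\<lambda>_. borel)) (\<lambda>\<omega>. restrict (\<lambda>s. ?X s \<omega>) {Price i})"
      by (rule indep_var_restrict[OF indep]) auto
    then have "indep_var borel ((\<lambda>f. f (Gap i)) \<circ> (\<lambda>\<omega>. restrict (\<lambda>s. ?X s \<omega>) {Gap i})) borel ((\<lambda>f. f (Price i)) \<circ> (\<lambda>\<omega>. restrict (\<lambda>s. ?X s \<omega>) {Price i}))"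
      by (rule indep_var_compose) measurable
    then have "indep_var borel (interarrival T i) borel (C i)" by (simp add: comp_def sources_def)
    then show ?thesis by (simp add: indep_var_distribution_eq G Q)
  qed
  ultimately have Y: "distr M (PiM UNIV (\<lambda>_::nat. borel \<Otimes>\<^sub>M borel)) (\<lambda>\<omega> i. ?Y i \<omega>) = PiM UNIV (\<lambda>_. G \<Otimes>\<^sub>M Q)"
    by (simp add: restrict_def)
  \<comment> \<open>Second grouping. The sequence of pairs and the end are functions
    \<open>?\<phi>\<close> and evaluation at \<open>End\<close> of the two restricted families, so
    the product form of the joint law carries over by taking images.\<close>
  let ?A = "range Gap \<union> range Price"
  have "indep_var (PiM ?A (\<lambda>_. borel)) (\<lambda>\<omega>. restrict (\<lambda>s. ?X s \<omega>) ?A) (PiM {End} (\<lambda>_. borel)) (\<lambda>\<omega>. restrict (\<lambda>s. ?X s \<omega>) {End})"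
    by (rule indep_var_restrict[OF indep]) auto
  then have split: "distr M (PiM ?A (\<lambda>_. borel) \<Otimes>\<^sub>M PiM {End} (\<lambda>_. borel)) (\<lambda>\<omega>. (restrict (\<lambda>s. ?X s \<omega>) ?A, restrict (\<lambda>s. ?X s \<omega>) {End})) =
      distr M (PiM ?A (\<lambda>_. borel)) (\<lambda>\<omega>. restrict (\<lambda>s. ?X s \<omega>) ?A) \<Otimes>\<^sub>M distr M (PiM {End} (\<lambda>_. borel)) (\<lambda>\<omega>. restrict (\<lambda>s. ?X s \<omega>) {End})"
    and XA [measurable]: "random_variable (PiM ?A (\<lambda>_. borel)) (\<lambda>\<omega>. restrict (\<lambda>s. ?X s \<omega>) ?A)"
    and XE [measurable]: "random_variable (PiM {End} (\<lambda>_. borel)) (\<lambda>\<omega>. restrict (\<lambda>s. ?X s \<omega>) {End})"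
    unfolding indep_var_distribution_eq by simp_all
  let ?\<phi> = "\<lambda>f i. (f (Gap i), f (Price i))"
  let ?S = "PiM UNIV (\<lambda>_::nat. borel \<Otimes>\<^sub>M borel)"
  have \<phi> [measurable]: "?\<phi> \<in> PiM ?A (\<lambda>_. borel) \<rightarrow>\<^sub>M ?S"
    by (rule measurable_PiM_single') (auto simp: space_pair_measure)
  have \<psi> [measurable]: "(\<lambda>f. f End) \<in> PiM {End} (\<lambda>_. borel) \<rightarrow>\<^sub>M borel"
    by measurable
  have \<phi>X: "distr M ?S (\<lambda>\<omega> i. ?Y i \<omega>) = distr (distr M (PiM ?A (\<lambda>_. borel)) (\<lambda>\<omega>. restrict (\<lambda>s. ?X s \<omega>) ?A)) ?S ?\<phi>"
    by (subst distr_distr[OF \<phi> XA]) (simp add: comp_def sources_def)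
  have \<psi>X: "distr M borel S = distr (distr M (PiM {End} (\<lambda>_. borel)) (\<lambda>\<omega>. restrict (\<lambda>s. ?X s \<omega>) {End})) borel (\<lambda>f. f End)"
    by (subst distr_distr[OF \<psi> XE]) (simp add: comp_def sources_def)
  interpret S: prob_space "distr M borel S" by (rule prob_space_distr) simp
  have "PiM UNIV (\<lambda>_::nat. G \<Otimes>\<^sub>M Q) \<Otimes>\<^sub>M distr M borel S = distr M ?S (\<lambda>\<omega> i. ?Y i \<omega>) \<Otimes>\<^sub>M distr M borel S"
    by (simp only: Y)
  also have "\<dots> = distr (distr M (PiM ?A (\<lambda>_. borel) \<Otimes>\<^sub>M PiM {End} (\<lambda>_. borel)) (\<lambda>\<omega>. (restrict (\<lambda>s. ?X s \<omega>) ?A, restrict (\<lambda>s. ?X s \<omega>) {End})))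
      (?S \<Otimes>\<^sub>M borel) (\<lambda>(f, g). (?\<phi> f, g End))"
    unfolding \<phi>X \<psi>X split
    using S.sigma_finite_measure_axioms by (intro pair_measure_distr) (simp_all add: \<psi>X)
  also have "\<dots> = distr M (?S \<Otimes>\<^sub>M borel) (\<lambda>\<omega>. (\<lambda>i. ?Y i \<omega>, S \<omega>))"
  proof (subst distr_distr)
    show "random_variable (PiM ?A (\<lambda>_. borel) \<Otimes>\<^sub>M PiM {End} (\<lambda>_. borel)) (\<lambda>\<omega>. (restrict (\<lambda>s. ?X s \<omega>) ?A, restrict (\<lambda>s. ?X s \<omega>) {End}))"
      by (rule measurable_Pair) (rule XA XE)+
  qed (simp_all add: comp_def sources_def)
  finally show ?thesis by simp
qed

section \<open>The auction model\<close>

locale auction_model = prob_space M for M :: "'a measure" +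
  fixes \<mu> \<gamma> :: real and q k b :: "real \<Rightarrow> real"
    and T C :: "nat \<Rightarrow> 'a \<Rightarrow> real" and T\<^sub>\<gamma> :: "'a \<Rightarrow> real"
  assumes mu_pos: "0 < \<mu>" and gamma_pos: "0 < \<gamma>"
    and poisson: "poisson_arrivals M \<mu> T"
    and prices_nonneg: "\<And>i. AE \<omega> in M. 0 \<le> C i \<omega>"
    and prices_cdf: "\<And>i. cdf (distr M borel (C i)) = q"
    and win_probability: "\<And>i \<beta>. 0 \<le> \<beta> \<Longrightarrow> measure M {\<omega> \<in> space M. C i \<omega> < \<beta>} = q \<beta>"
    and end_time: "distributed M lborel T\<^sub>\<gamma> (exponential_density \<gamma>)"
    and independent: "indep_vars (\<lambda>_. borel) (sources T C T\<^sub>\<gamma>) UNIV"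
    and k_mono: "mono_on {0..} k"
    and policy: "b \<in> policies"
begin

text \<open>
  \<open>b\<close> and \<open>k\<close> are arbitrary at negative ages, which do not occur; these versions are measurable on
  the whole line.
\<close>

definition "bid a = b (max 0 a)"
definition "worth a = k (max 0 a)"
definition "price_law = distr M borel (C 0)"

lemma measurable_sources [measurable]:
  "random_variable borel (interarrival T i)" "random_variable borel (C i)" "random_variable borel T\<^sub>\<gamma>"
proof -
  have rv: "random_variable borel (sources T C T\<^sub>\<gamma> s)" for s using independent by (auto simp: indep_vars_def)
  show "random_variable borel (interarrival T i)" "random_variable borel (C i)" "random_variable borel T\<^sub>\<gamma>"
    using rv[of "Gap i"] rv[of "Price i"] rv[of End] by (auto simp: sources_def)
qed

lemma measurable_bid [measurable]: "bid \<in> borel_measurable borel"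
proof -
  have "(\<lambda>a. max 0 a :: real) \<in> borel \<rightarrow>\<^sub>M restrict_space borel {0..}"
    by (rule measurable_restrict_space2) auto
  moreover have "b \<in> borel_measurable (restrict_space borel {0..})" using policy by (simp add: policies_def)
  ultimately show ?thesis unfolding bid_def by (rule measurable_compose)
qed

lemma measurable_worth [measurable]: "worth \<in> borel_measurable borel"
proof -
  have "mono worth"
    using k_mono by (auto simp: worth_def mono_on_def intro!: monoI)
  then show ?thesis by (rule borel_measurable_mono)
qed

lemma bid_nonneg: "0 \<le> bid a"
  using policy by (simp add: policies_def bid_def)

lemma real_distribution_price: "real_distribution (distr M borel (C i))"
  by (rule real_distribution_distr) simp

sublocale bidding price_law \<mu> \<gamma> bid
proof -
  interpret Q: real_distribution price_law unfolding price_law_def by (rule real_distribution_price)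
  show "bidding price_law \<mu> \<gamma> bid"
    by unfold_locales (use mu_pos gamma_pos in \<open>auto simp: price_law_def\<close>)
qed

section \<open>Transfer between the probability space and the path law\<close>

definition source_path :: "'a \<Rightarrow> nat \<Rightarrow> real \<times> real" where
  "source_path \<omega> = (\<lambda>i. (interarrival T i \<omega>, C i \<omega>))"

lemma distr_path_end:
  "distr M (path_law \<Otimes>\<^sub>M borel) (\<lambda>\<omega>. (source_path \<omega>, T\<^sub>\<gamma> \<omega>)) = path_law \<Otimes>\<^sub>M density lborel (exponential_density \<gamma>)"
proof -
  have expo: "distr M borel X = density lborel (exponential_density l)"
    if "distributed M lborel X (exponential_density l)" for X l
    using distributed_distr_eq_density[OF that] by (metis distr_cong sets_lborel)
  have gap: "distr M borel (interarrival T i) = gap_law" for i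
    unfolding gap_law_def using poisson by (intro expo) (simp add: poisson_arrivals_def)
  \<comment> \<open>Only the common distribution function is given; it determines the law, so all
    prices have the law of the price at index 0.\<close>
  have price: "distr M borel (C i) = price_law" for i
    unfolding price_law_def by (intro cdf_unique real_distribution_price) (simp add: prices_cdf)
  have "distr M (PiM UNIV (\<lambda>_::nat. borel \<Otimes>\<^sub>M borel) \<Otimes>\<^sub>M borel) (\<lambda>\<omega>. (source_path \<omega>, T\<^sub>\<gamma> \<omega>)) =
      PiM UNIV (\<lambda>_::nat. gap_law \<Otimes>\<^sub>M price_law) \<Otimes>\<^sub>M distr M borel T\<^sub>\<gamma>"
    unfolding source_path_def by (rule distr_sources[OF independent gap price])
  moreover have "sets (path_law \<Otimes>\<^sub>M borel) = sets (PiM UNIV (\<lambda>_::nat. borel \<Otimes>\<^sub>M borel) \<Otimes>\<^sub>M borel)"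
    by (intro sets_pair_measure_cong sets_path_law refl)
  ultimately show ?thesis
    unfolding path_law_def auction_law_def expo[OF end_time, symmetric]
    by (subst (asm) distr_cong[OF refl _ refl]) (rule sym, assumption, assumption)
qed

lemma measurable_source_path [measurable]: "source_path \<in> M \<rightarrow>\<^sub>M path_law"
  unfolding source_path_def measurable_cong_sets[OF refl sets_path_law]
  by (rule measurable_PiM_single') (auto simp: space_pair_measure)

lemma nn_integral_path_end:
  assumes [measurable]: "f \<in> borel_measurable (path_law \<Otimes>\<^sub>M borel)"
  shows "(\<integral>\<^sup>+\<omega>. f (source_path \<omega>, T\<^sub>\<gamma> \<omega>) \<partial>M) =
    (\<integral>\<^sup>+x. \<integral>\<^sup>+s. f (x, s) \<partial>density lborel (exponential_density \<gamma>) \<partial>path_law)"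
proof -
  interpret H: prob_space "density lborel (exponential_density \<gamma>)"
    using gamma_pos by (rule prob_space_exponential_density)
  have "(\<integral>\<^sup>+\<omega>. f (source_path \<omega>, T\<^sub>\<gamma> \<omega>) \<partial>M) = (\<integral>\<^sup>+z. f z \<partial>distr M (path_law \<Otimes>\<^sub>M borel) (\<lambda>\<omega>. (source_path \<omega>, T\<^sub>\<gamma> \<omega>)))"
    by (subst nn_integral_distr) auto
  also have "\<dots> = (\<integral>\<^sup>+z. f z \<partial>(path_law \<Otimes>\<^sub>M density lborel (exponential_density \<gamma>)))"
    by (simp only: distr_path_end)
  also have "\<dots> = (\<integral>\<^sup>+x. \<integral>\<^sup>+s. f (x, s) \<partial>density lborel (exponential_density \<gamma>) \<partial>path_law)"
    by (subst H.nn_integral_fst[symmetric]) simp_all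
  finally show ?thesis .
qed

lemma nn_integral_path:
  assumes [measurable]: "f \<in> borel_measurable path_law"
  shows "(\<integral>\<^sup>+\<omega>. f (source_path \<omega>) \<partial>M) = (\<integral>\<^sup>+x. f x \<partial>path_law)"
proof -
  interpret H: prob_space "density lborel (exponential_density \<gamma>)"
    using gamma_pos by (rule prob_space_exponential_density)
  show ?thesis using nn_integral_path_end[of "\<lambda>z. f (fst z)"] H.emeasure_space_1 by simp
qed

lemma arrivals_source_path: "arrivals (source_path \<omega>) = (\<lambda>i. T i \<omega>)"
proof
  show "arrivals (source_path \<omega>) i = T i \<omega>" for i
    by (induction i) (simp_all add: arrivals_Suc source_path_def interarrival_def)
qed

lemma measurable_arrival_time [measurable]: "T n \<in> borel_measurable M"
proof -
  have "(\<lambda>\<omega>. arrivals (source_path \<omega>) n) \<in> borel_measurable M" by measurable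
  then show ?thesis by (simp add: arrivals_source_path)
qed

lemma arrival_times:
  assumes \<omega>: "\<omega> \<in> space M"
  shows "0 < T n \<omega>" and "T n \<omega> < T (Suc n) \<omega>"
proof -
  have pos: "0 < interarrival T i \<omega>" for i using poisson \<omega> by (simp add: poisson_arrivals_def)
  show less: "T n \<omega> < T (Suc n) \<omega>" for n using pos[of "Suc n"] by (simp add: interarrival_def)
  show "0 < T n \<omega>"
    by (induction n) (use pos[of 0] less in \<open>auto simp: interarrival_def intro: less_trans\<close>)
qed

lemma snd_source_path: "snd (source_path \<omega> i) = C i \<omega>"
  by (simp add: source_path_def)

text \<open>One joint induction: \<open>b\<close> and \<open>bid\<close> agree only at nonnegative
  ages, so each step of the equality needs the sign of the age before it, which in turn rests on the
  gaps being positive everywhere.\<close>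

lemma auction_age_source_path:
  assumes \<omega>: "\<omega> \<in> space M" and a: "0 \<le> a"
  shows "auction_age b a (\<lambda>j. T j \<omega>) (\<lambda>j. C j \<omega>) n = age a (source_path \<omega>) n" (is ?eq)
    and "0 \<le> age a (source_path \<omega>) n" (is ?nonneg)
proof -
  have "?eq \<and> ?nonneg"
  proof (induction n)
    case 0
    then show ?case using a arrival_times(1)[OF \<omega>, of 0] by (simp add: arrivals_source_path)
  next
    case (Suc n)
    let ?a = "age a (source_path \<omega>) n"
    have "max 0 ?a = ?a" using Suc by (simp add: max_absorb2)
    then have "bid ?a = b ?a" by (simp only: bid_def[of ?a])
    then show ?case using Suc arrival_times(2)[OF \<omega>, of n] by (auto simp: arrivals_source_path snd_source_path)
  qed
  then show ?eq ?nonneg by auto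
qed

lemma won_source_path:
  assumes "\<omega> \<in> space M" "0 \<le> a"
  shows "won b a (\<lambda>j. T j \<omega>) (\<lambda>j. C j \<omega>) n \<longleftrightarrow> wins a (source_path \<omega>) n"
proof -
  have "max 0 (age a (source_path \<omega>) n) = age a (source_path \<omega>) n"
    using auction_age_source_path(2)[OF assms, of n] by (simp add: max_absorb2)
  then have "bid (age a (source_path \<omega>) n) = b (age a (source_path \<omega>) n)"
    by (simp only: bid_def[of "age a (source_path \<omega>) n"])
  then show ?thesis
    using auction_age_source_path(1)[OF assms, of n] by (simp add: won_def snd_source_path)
qed

text \<open>Discounting as killing: the end is exponential and independent of the path, so given the
  path it comes after the arrival time \<open>t\<close> with probability
  \<open>exp (- \<gamma> * t)\<close>.\<close>

lemma nn_integral_before_end: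
  assumes [measurable]: "f \<in> borel_measurable path_law"
  shows "(\<integral>\<^sup>+\<omega>. f (source_path \<omega>) * of_bool (T n \<omega> \<le> T\<^sub>\<gamma> \<omega>) \<partial>M) =
      (\<integral>\<^sup>+x. ennreal (exp (- \<gamma> * arrivals x n)) * f x \<partial>path_law)" (is ?le)
    and "(\<integral>\<^sup>+\<omega>. f (source_path \<omega>) * of_bool (T n \<omega> < T\<^sub>\<gamma> \<omega>) \<partial>M) =
      (\<integral>\<^sup>+x. ennreal (exp (- \<gamma> * arrivals x n)) * f x \<partial>path_law)" (is ?lt)
proof -
  \<comment> \<open>A point of the path space may have negative arrival times. The maximum is
    removed on \<open>M\<close>, where arrival times are positive, and the integral is then carried
    back.\<close>
  have max: "(\<integral>\<^sup>+x. f x * ennreal (exp (- \<gamma> * max 0 (arrivals x n))) \<partial>path_law) =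
      (\<integral>\<^sup>+x. ennreal (exp (- \<gamma> * arrivals x n)) * f x \<partial>path_law)"
  proof -
    have "(\<integral>\<^sup>+x. f x * ennreal (exp (- \<gamma> * max 0 (arrivals x n))) \<partial>path_law) =
      (\<integral>\<^sup>+\<omega>. f (source_path \<omega>) * ennreal (exp (- \<gamma> * max 0 (arrivals (source_path \<omega>) n))) \<partial>M)"
      by (subst nn_integral_path[symmetric]) auto
    also have "\<dots> = (\<integral>\<^sup>+\<omega>. ennreal (exp (- \<gamma> * arrivals (source_path \<omega>) n)) * f (source_path \<omega>) \<partial>M)"
      by (intro nn_integral_cong) (simp add: arrivals_source_path less_imp_le[OF arrival_times(1)] max_absorb2 mult.commute)
    also have "\<dots> = (\<integral>\<^sup>+x. ennreal (exp (- \<gamma> * arrivals x n)) * f x \<partial>path_law)"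
      by (subst nn_integral_path[symmetric]) auto
    finally show ?thesis .
  qed
  show ?le
    using nn_integral_path_end[of "\<lambda>z. f (fst z) * of_bool (arrivals (fst z) n \<le> snd z)"] gamma_pos max
    by (simp add: nn_integral_cmult emeasure_exponential_tail arrivals_source_path)
  show ?lt
    using nn_integral_path_end[of "\<lambda>z. f (fst z) * of_bool (arrivals (fst z) n < snd z)"] gamma_pos max
    by (simp add: nn_integral_cmult emeasure_exponential_tail arrivals_source_path)
qed

lemma nn_integral_path_gain_source_path:
  assumes [measurable]: "case_prod r \<in> borel_measurable (borel \<Otimes>\<^sub>M borel)"
  shows "(\<integral>\<^sup>+\<omega>. (\<Sum>n. path_gain \<rho> r a (source_path \<omega>) n) \<partial>M) = total_gain \<rho> (mean_gain r) a"
  using nn_integral_path[of "\<lambda>x. \<Sum>n. path_gain \<rho> r a x n"] nn_integral_suminf_path_gain[OF assms] by simp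

section \<open>Signed gains of the model and the formula for the value at every age\<close>

definition "surplus_at a c = ennreal (worth a - c)"
definition "loss_at a c = ennreal (c - worth a)"

lemma measurable_surplus_loss [measurable]:
  "case_prod surplus_at \<in> borel_measurable (borel \<Otimes>\<^sub>M borel)"
  "case_prod loss_at \<in> borel_measurable (borel \<Otimes>\<^sub>M borel)"
  unfolding surplus_at_def loss_at_def by measurable

abbreviation "surplus \<equiv> mean_gain surplus_at"
abbreviation "loss \<equiv> mean_gain loss_at"

lemma win_prob_eq: "win_prob a = q (bid a)"
proof -
  have "win_prob a = measure M (C 0 -` {..<bid a} \<inter> space M)"
    unfolding win_prob_def unfolding price_law_def by (rule measure_distr) auto
  also have "C 0 -` {..<bid a} \<inter> space M = {\<omega> \<in> space M. C 0 \<omega> < bid a}" by auto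
  finally show ?thesis using win_probability[OF bid_nonneg] by simp
qed

lemma surplus_loss:
  shows "surplus a < \<top>" and "loss a < \<top>"
    and "enn2real (surplus a) - enn2real (loss a) = utility q (worth a) (bid a)"
proof -
  interpret Q: real_distribution price_law unfolding price_law_def by (rule real_distribution_price)
  have cdf: "cdf price_law = q" by (simp add: price_law_def prices_cdf)
  have nonneg: "AE c in price_law. 0 \<le> c"
    unfolding price_law_def by (subst AE_distr_iff) (use prices_nonneg[of 0] in auto)
  \<comment> \<open>The winning probability and the distribution function are both given by
    \<open>q\<close>, so the price law has no atom at a bid.\<close>
  have no_atom: "measure price_law {..<bid a} = cdf price_law (bid a)"
    using win_prob_eq[of a] by (simp add: win_prob_def cdf)
  show "surplus a < \<top>" "loss a < \<top>"
    "enn2real (surplus a) - enn2real (loss a) = utility q (worth a) (bid a)"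
    using Q.utility_eq[OF nonneg bid_nonneg no_atom, of "worth a"]
    by (simp_all add: mean_gain_def surplus_at_def loss_at_def cdf)
qed

lemma discounted_gain_parts:
  assumes "\<omega> \<in> space M" "0 \<le> a"
  shows "ennreal (discounted_gain \<gamma> k b a (\<lambda>j. T j \<omega>) (\<lambda>j. C j \<omega>) n) = path_gain 1 surplus_at a (source_path \<omega>) n"
    and "ennreal (- discounted_gain \<gamma> k b a (\<lambda>j. T j \<omega>) (\<lambda>j. C j \<omega>) n) = path_gain 1 loss_at a (source_path \<omega>) n"
proof -
  have worth: "k (age a (source_path \<omega>) n) = worth (age a (source_path \<omega>) n)"
    using auction_age_source_path(2)[OF assms, of n] by (simp add: worth_def)
  have eq: "discounted_gain \<gamma> k b a (\<lambda>j. T j \<omega>) (\<lambda>j. C j \<omega>) n = exp (- \<gamma> * T n \<omega>) *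
      ((worth (age a (source_path \<omega>) n) - C n \<omega>) * of_bool (wins a (source_path \<omega>) n))"
    by (simp add: discounted_gain_def won_source_path[OF assms] auction_age_source_path(1)[OF assms] worth mult.assoc)
  show "ennreal (discounted_gain \<gamma> k b a (\<lambda>j. T j \<omega>) (\<lambda>j. C j \<omega>) n) = path_gain 1 surplus_at a (source_path \<omega>) n"
    unfolding eq path_gain_1
    by (auto simp: surplus_at_def ennreal_mult' arrivals_source_path snd_source_path)
  have eq': "- discounted_gain \<gamma> k b a (\<lambda>j. T j \<omega>) (\<lambda>j. C j \<omega>) n = exp (- \<gamma> * T n \<omega>) *
      ((C n \<omega> - worth (age a (source_path \<omega>) n)) * of_bool (wins a (source_path \<omega>) n))"
    unfolding eq by (simp add: algebra_simps)
  show "ennreal (- discounted_gain \<gamma> k b a (\<lambda>j. T j \<omega>) (\<lambda>j. C j \<omega>) n) = path_gain 1 loss_at a (source_path \<omega>) n"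
    unfolding eq' path_gain_1
    by (auto simp: loss_at_def ennreal_mult' arrivals_source_path snd_source_path)
qed

lemma nn_integral_discounted_gain:
  assumes a: "0 \<le> a"
  shows "(\<integral>\<^sup>+\<omega>. (\<Sum>n. ennreal (discounted_gain \<gamma> k b a (\<lambda>j. T j \<omega>) (\<lambda>j. C j \<omega>) n)) \<partial>M) = total_gain 1 surplus a"
    and "(\<integral>\<^sup>+\<omega>. (\<Sum>n. ennreal (- discounted_gain \<gamma> k b a (\<lambda>j. T j \<omega>) (\<lambda>j. C j \<omega>) n)) \<partial>M) = total_gain 1 loss a"
  by (simp_all add: discounted_gain_parts[OF _ a] nn_integral_path_gain_source_path cong: nn_integral_cong)

text \<open>Absolute convergence at age 0 bounds the sum of the two parts, hence each of them, and
  the tail form passes both bounds on to later ages.\<close>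

lemma value_converges_finite:
  assumes "value_converges M \<gamma> k T C b 0" "0 \<le> a"
  shows "total_gain 1 surplus a < \<top>" "total_gain 1 loss a < \<top>"
proof -
  have "(\<integral>\<^sup>+\<omega>. (\<Sum>n. path_gain 1 surplus_at 0 (source_path \<omega>) n + path_gain 1 loss_at 0 (source_path \<omega>) n) \<partial>M) < \<top>"
    using assms(1) by (simp add: value_converges_def ennreal_abs_eq discounted_gain_parts cong: nn_integral_cong)
  also have "(\<integral>\<^sup>+\<omega>. (\<Sum>n. path_gain 1 surplus_at 0 (source_path \<omega>) n + path_gain 1 loss_at 0 (source_path \<omega>) n) \<partial>M)
     = total_gain 1 surplus 0 + total_gain 1 loss 0"
    by (simp add: suminf_add[symmetric] summableI nn_integral_add nn_integral_path_gain_source_path)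
  finally have "total_gain 1 surplus 0 < \<top>" "total_gain 1 loss 0 < \<top>" by auto
  then show "total_gain 1 surplus a < \<top>" "total_gain 1 loss a < \<top>"
    using assms(2) by (auto intro!: total_gain_finite)
qed

text \<open>Measurability of \<open>b\<close> and \<open>k\<close> is available on
  \<open>{0..}\<close> only. The gain is therefore rewritten through path gains, which are built
  from \<open>bid\<close> and \<open>worth\<close> and agree with it on the whole space.\<close>

lemma measurable_discounted_gain:
  assumes a: "0 \<le> a"
  shows "(\<lambda>\<omega>. discounted_gain \<gamma> k b a (\<lambda>j. T j \<omega>) (\<lambda>j. C j \<omega>) n) \<in> borel_measurable M"
proof -
  have "discounted_gain \<gamma> k b a (\<lambda>j. T j \<omega>) (\<lambda>j. C j \<omega>) n =
      enn2real (path_gain 1 surplus_at a (source_path \<omega>) n) - enn2real (path_gain 1 loss_at a (source_path \<omega>) n)"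
    if "\<omega> \<in> space M" for \<omega>
    unfolding discounted_gain_parts[OF that a, symmetric] by (rule real_eq_enn2real_diff)
  moreover have "(\<lambda>\<omega>. enn2real (path_gain 1 surplus_at a (source_path \<omega>) n) - enn2real (path_gain 1 loss_at a (source_path \<omega>) n))
      \<in> borel_measurable M" by measurable
  ultimately show ?thesis by (simp cong: measurable_cong)
qed

lemma policy_value_eq:
  assumes "value_converges M \<gamma> k T C b 0" and a: "0 \<le> a"
  shows "policy_value M \<gamma> k T C b a = enn2real (total_gain 1 surplus a) - enn2real (total_gain 1 loss a)"
  unfolding policy_value_def
  using value_converges_finite[OF assms]
  by (subst integral_suminf_eq_enn2real_diff)
     (simp_all add: measurable_discounted_gain[OF a] nn_integral_discounted_gain[OF a])

text \<open>The solved equations for surplus and loss have the same factor and the same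
  \<open>A\<close>, so they can be subtracted. The integrability part of
  \<open>total_gain_ode\<close> is what permits subtracting the two integrals.\<close>

lemma policy_value_formula:
  assumes conv: "value_converges M \<gamma> k T C b 0" and a: "0 \<le> a"
  defines "V \<equiv> policy_value M \<gamma> k T C b" and "A \<equiv> cumulative_rate \<gamma> \<mu> q b"
  shows "V a = exp (A a) * (V 0 - (LBINT t:{0..a}. exp (- A t) * \<mu> * utility q (V 0 + k t) (b t)))"
proof -
  note fin = value_converges_finite[OF conv order.refl]
  let ?S = "\<lambda>a. enn2real (total_gain 1 surplus a)" and ?L = "\<lambda>a. enn2real (total_gain 1 loss a)"
  have hz: "hazard t = A t" for t
    unfolding hazard_def A_def cumulative_rate_def
    by (rule set_lebesgue_integral_cong) (auto simp: win_prob_eq bid_def)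
  note S = total_gain_ode[of surplus, OF _ _ fin(1) a, unfolded hz]
  note L = total_gain_ode[of loss, OF _ _ fin(2) a, unfolded hz]
  have V: "V t = ?S t - ?L t" if "0 \<le> t" for t
    unfolding V_def using policy_value_eq[OF conv that] .
  have "(LBINT t:{0..a}. exp (- A t) * \<mu> * utility q (V 0 + k t) (b t)) =
      (LBINT t:{0..a}. exp (- A t) * \<mu> * (enn2real (surplus t) + win_prob t * ?S 0) -
         exp (- A t) * \<mu> * (enn2real (loss t) + win_prob t * ?L 0))"
  proof (rule set_lebesgue_integral_cong)
    show "\<forall>t. t \<in> {0..a} \<longrightarrow> exp (- A t) * \<mu> * utility q (V 0 + k t) (b t) =
        exp (- A t) * \<mu> * (enn2real (surplus t) + win_prob t * ?S 0) -
         exp (- A t) * \<mu> * (enn2real (loss t) + win_prob t * ?L 0)"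
    proof (intro allI impI)
      fix t assume "t \<in> {0..a}"
      then have kb: "k t = worth t" "b t = bid t" by (simp_all add: worth_def bid_def)
      \<comment> \<open>The utility is affine in the value of winning, with slope the winning
        probability; so the two constants at age 0 merge into \<open>V 0\<close> inside its first
        argument.\<close>
      have "utility q (V 0 + k t) (b t) = win_prob t * V 0 + (enn2real (surplus t) - enn2real (loss t))"
        unfolding kb surplus_loss(3) win_prob_eq by (simp add: utility_def algebra_simps)
      also have "\<dots> = (enn2real (surplus t) + win_prob t * ?S 0) - (enn2real (loss t) + win_prob t * ?L 0)"
        by (simp add: V algebra_simps)
      finally show "exp (- A t) * \<mu> * utility q (V 0 + k t) (b t) =
        exp (- A t) * \<mu> * (enn2real (surplus t) + win_prob t * ?S 0) -
         exp (- A t) * \<mu> * (enn2real (loss t) + win_prob t * ?L 0)"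
        by (simp only: right_diff_distrib)
    qed
  qed simp
  also have "\<dots> = (LBINT t:{0..a}. exp (- A t) * \<mu> * (enn2real (surplus t) + win_prob t * ?S 0)) -
      (LBINT t:{0..a}. exp (- A t) * \<mu> * (enn2real (loss t) + win_prob t * ?L 0))"
    by (rule set_integral_diff(2)) (auto intro!: S L surplus_loss)
  finally have I: "(LBINT t:{0..a}. exp (- A t) * \<mu> * utility q (V 0 + k t) (b t)) = \<dots>" .
  have "?S a - ?L a = exp (A a) * (?S 0 - ?L 0 - (LBINT t:{0..a}. exp (- A t) * \<mu> * utility q (V 0 + k t) (b t)))"
    unfolding I right_diff_distrib using S(2) L(2) surplus_loss by (simp add: right_diff_distrib)
  then show ?thesis by (simp only: V[OF a] V[OF order.refl])
qed

section \<open>The first win, the number of wins and the value at age 0\<close>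

definition first_win_age :: "(nat \<Rightarrow> real \<times> real) \<Rightarrow> real" where
  "first_win_age x = (if \<exists>n. wins 0 x n then age 0 x (LEAST n. wins 0 x n) else 0)"

lemma measurable_first_win_age [measurable]: "first_win_age \<in> borel_measurable path_law"
proof -
  have "(\<lambda>x. age 0 x (LEAST n. wins 0 x n)) \<in> borel_measurable path_law"
    by (rule measurable_compose_countable[of "\<lambda>n x. age 0 x n"]) measurable
  then show ?thesis unfolding first_win_age_def by measurable
qed

definition wins_in_time :: "'a set" where
  "wins_in_time = {\<omega> \<in> space M. win_age b (\<lambda>i. T i \<omega>) (\<lambda>i. C i \<omega>) < ereal (T\<^sub>\<gamma> \<omega>)}"

text \<open>Without a win, \<open>first_win_age\<close> is 0 by default; this is also the value of
  \<open>real_of_ereal \<infinity>\<close>, so the second equation holds on the whole space.\<close>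

lemma win_age_source_path:
  assumes "\<omega> \<in> space M"
  shows "win_age b (\<lambda>i. T i \<omega>) (\<lambda>i. C i \<omega>) =
      (if \<exists>n. wins 0 (source_path \<omega>) n then ereal (first_win_age (source_path \<omega>)) else \<infinity>)"
    and "real_of_ereal (win_age b (\<lambda>i. T i \<omega>) (\<lambda>i. C i \<omega>)) = first_win_age (source_path \<omega>)"
    and "0 \<le> first_win_age (source_path \<omega>)"
proof -
  have "won b 0 (\<lambda>i. T i \<omega>) (\<lambda>i. C i \<omega>) = wins 0 (source_path \<omega>)"
    using won_source_path[OF assms order.refl] by (simp add: fun_eq_iff)
  then show "win_age b (\<lambda>i. T i \<omega>) (\<lambda>i. C i \<omega>) =
      (if \<exists>n. wins 0 (source_path \<omega>) n then ereal (first_win_age (source_path \<omega>)) else \<infinity>)"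
    "real_of_ereal (win_age b (\<lambda>i. T i \<omega>) (\<lambda>i. C i \<omega>)) = first_win_age (source_path \<omega>)"
    "0 \<le> first_win_age (source_path \<omega>)"
    using auction_age_source_path[OF assms order.refl]
    by (auto simp: win_age_def first_win_age_def)
qed

text \<open>Only the index of the first win can contribute. Started at age 0, the age there has
  never been reset and equals the arrival time, which is why comparing an age with the end of the
  sequence makes sense.\<close>

lemma suminf_first_win:
  assumes \<omega>: "\<omega> \<in> space M"
  shows "(\<Sum>n. of_bool (wins 0 (source_path \<omega>) n \<and> (\<forall>i<n. \<not> wins 0 (source_path \<omega>) i)) *
      g (age 0 (source_path \<omega>) n) * of_bool (T n \<omega> < T\<^sub>\<gamma> \<omega>)) =
    (g (first_win_age (source_path \<omega>)) * indicator wins_in_time \<omega> :: ennreal)"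
    (is "suminf ?f = _")
proof (cases "\<exists>n. wins 0 (source_path \<omega>) n")
  case False
  then have "?f = (\<lambda>_. 0)" "\<omega> \<notin> wins_in_time"
    by (auto simp: wins_in_time_def win_age_source_path)
  then show ?thesis by simp
next
  case True
  define m where "m = (LEAST n. wins 0 (source_path \<omega>) n)"
  have m: "wins 0 (source_path \<omega>) m" "\<forall>i<m. \<not> wins 0 (source_path \<omega>) i"
    unfolding m_def using True by (auto intro: LeastI_ex dest: not_less_Least)
  have uniq: "n = m" if "wins 0 (source_path \<omega>) n" "\<forall>i<n. \<not> wins 0 (source_path \<omega>) i" for n
    using that m by (meson linorder_neqE_nat)
  have "age 0 (source_path \<omega>) m = T m \<omega>"
    using age_before_first_win[OF m(2)] by (simp add: arrivals_source_path)
  moreover have first: "first_win_age (source_path \<omega>) = age 0 (source_path \<omega>) m"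
    using True by (simp add: first_win_age_def m_def)
  ultimately have "\<omega> \<in> wins_in_time \<longleftrightarrow> T m \<omega> < T\<^sub>\<gamma> \<omega>"
    using True \<omega> by (simp add: wins_in_time_def win_age_source_path)
  then have fm: "?f m = g (first_win_age (source_path \<omega>)) * indicator wins_in_time \<omega>"
    using m by (simp add: first indicator_def)
  have "?f n = 0" if "n \<noteq> m" for n using uniq[of n] that by auto
  then have "suminf ?f = (\<Sum>n\<in>{m}. ?f n)" by (intro suminf_finite) auto
  then show ?thesis by (simp only: fm sum.insert finite.emptyI sum.empty empty_iff not_False_eq_True add_0_right)
qed

text \<open>Summing over the possible index of the first win lets killing be traded for discounting
  term by term; what remains is the total gain with \<open>\<rho> = 0\<close>.\<close>

lemma nn_integral_first_win:
  assumes [measurable]: "g \<in> borel_measurable borel"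
  shows "(\<integral>\<^sup>+\<omega>. g (first_win_age (source_path \<omega>)) * indicator wins_in_time \<omega> \<partial>M) =
    total_gain 0 (\<lambda>a. win a * g a) 0"
proof -
  let ?h = "\<lambda>x n. of_bool (wins 0 x n \<and> (\<forall>i<n. \<not> wins 0 x i)) * g (age 0 x n)"
  have "(\<integral>\<^sup>+\<omega>. g (first_win_age (source_path \<omega>)) * indicator wins_in_time \<omega> \<partial>M) =
    (\<integral>\<^sup>+\<omega>. (\<Sum>n. ?h (source_path \<omega>) n * of_bool (T n \<omega> < T\<^sub>\<gamma> \<omega>)) \<partial>M)"
    by (intro nn_integral_cong suminf_first_win[symmetric])
  also have "\<dots> = (\<Sum>n. \<integral>\<^sup>+\<omega>. ?h (source_path \<omega>) n * of_bool (T n \<omega> < T\<^sub>\<gamma> \<omega>) \<partial>M)"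
    by (rule nn_integral_suminf) measurable
  also have "\<dots> = (\<Sum>n. \<integral>\<^sup>+x. ennreal (exp (- \<gamma> * arrivals x n)) * ?h x n \<partial>path_law)"
    by (subst nn_integral_before_end(2)) auto
  also have "\<dots> = (\<Sum>n. \<integral>\<^sup>+x. path_gain 0 (\<lambda>a _. g a) 0 x n \<partial>path_law)"
    by (simp only: path_gain_0)
  also have "\<dots> = total_gain 0 (mean_gain (\<lambda>a _. g a)) 0"
    unfolding total_gain_def by (subst nn_integral_path_gain) auto
  finally show ?thesis by (simp add: mean_gain_age_only[abs_def])
qed

lemma measurable_wins_in_time [measurable]: "wins_in_time \<in> events"
proof -
  have "wins_in_time = {\<omega> \<in> space M. (\<exists>n. wins 0 (source_path \<omega>) n) \<and> first_win_age (source_path \<omega>) < T\<^sub>\<gamma> \<omega>}"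
    by (auto simp: wins_in_time_def win_age_source_path split: if_splits)
  also have "\<dots> \<in> events" by measurable
  finally show ?thesis .
qed

lemma prob_wins_in_time: "ennreal (prob wins_in_time) = total_gain 0 win 0"
  using nn_integral_first_win[of "\<lambda>_. 1"] by (simp add: emeasure_eq_measure)

text \<open>Counting is a gain of 1 per win, killed at the end. The bound of
  \<open>total_wins_le\<close> makes the count almost surely finite, so the passage to reals loses
  nothing.\<close>

lemma expectation_number_won:
  "(\<integral>\<omega>. real (number_won b (\<lambda>i. T i \<omega>) (\<lambda>i. C i \<omega>) (T\<^sub>\<gamma> \<omega>)) \<partial>M) = enn2real (total_gain 1 win 0)"
proof -
  let ?h = "\<lambda>x n. of_bool (wins 0 x n) :: ennreal"
  have "(\<integral>\<^sup>+\<omega>. (\<Sum>n. ?h (source_path \<omega>) n * of_bool (T n \<omega> \<le> T\<^sub>\<gamma> \<omega>)) \<partial>M) =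
      (\<Sum>n. \<integral>\<^sup>+\<omega>. ?h (source_path \<omega>) n * of_bool (T n \<omega> \<le> T\<^sub>\<gamma> \<omega>) \<partial>M)"
    by (rule nn_integral_suminf) measurable
  also have "\<dots> = (\<Sum>n. \<integral>\<^sup>+x. ennreal (exp (- \<gamma> * arrivals x n)) * ?h x n \<partial>path_law)"
    by (subst nn_integral_before_end(1)) auto
  also have "\<dots> = (\<Sum>n. \<integral>\<^sup>+x. path_gain 1 (\<lambda>_ _. 1) 0 x n \<partial>path_law)"
    by (simp only: path_gain_1 mult_1_right)
  also have "\<dots> = total_gain 1 (mean_gain (\<lambda>_ _. 1)) 0"
    unfolding total_gain_def by (subst nn_integral_path_gain) auto
  also have "mean_gain (\<lambda>_ _. 1) = win"
    using mean_gain_age_only[of "\<lambda>_. 1"] by (simp add: fun_eq_iff)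
  finally have total: "(\<integral>\<^sup>+\<omega>. (\<Sum>n. ?h (source_path \<omega>) n * of_bool (T n \<omega> \<le> T\<^sub>\<gamma> \<omega>)) \<partial>M) = total_gain 1 win 0" .
  have fin: "total_gain 1 win 0 < \<top>"
    using total_wins_le[of 0] by (rule order.strict_trans1) simp
  have "(\<integral>\<omega>. real (number_won b (\<lambda>i. T i \<omega>) (\<lambda>i. C i \<omega>) (T\<^sub>\<gamma> \<omega>)) \<partial>M) =
      (\<integral>\<omega>. enn2real (\<Sum>n. ?h (source_path \<omega>) n * of_bool (T n \<omega> \<le> T\<^sub>\<gamma> \<omega>)) \<partial>M)"
    by (intro Bochner_Integration.integral_cong refl)
       (simp add: number_won_def real_card_eq_enn2real_suminf won_source_path of_bool_conj mult.commute)
  also have "\<dots> = enn2real (total_gain 1 win 0)"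
    using fin unfolding total[symmetric] by (intro integral_enn2real) auto
  finally show ?thesis .
qed

text \<open>At each age the winning probability times the utility given a win is the mean gain of
  the auction, and the gain of the first win depends on the price only through that mean.\<close>

lemma integral_first_win:
  assumes conv: "value_converges M \<gamma> k T C b 0"
  defines "h \<equiv> \<lambda>a. utility_given_win q (worth a) (bid a)"
  shows "(\<integral>\<omega>. h (first_win_age (source_path \<omega>)) * indicator wins_in_time \<omega> \<partial>M) =
    enn2real (total_gain 0 surplus 0) - enn2real (total_gain 0 loss 0)"
proof -
  have h_eq: "h a = (enn2real (surplus a) - enn2real (loss a)) / win_prob a" for a
    by (simp add: h_def utility_given_win_def surplus_loss win_prob_eq)
  have [measurable]: "h \<in> borel_measurable borel" unfolding h_eq by measurable
  \<comment> \<open>If winning has probability 0, then \<open>h a\<close> is 0 by the convention for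
    division, and both mean gains vanish as well.\<close>
  have wh: "win_prob a * h a = enn2real (surplus a) - enn2real (loss a)" for a
  proof (cases "win_prob a = 0")
    case True
    then have "win a = 0" by (simp add: win_eq_win_prob)
    then have "{..<bid a} \<in> null_sets price_law" by (simp add: win_def null_sets_def sets_Q)
    then have AE: "AE c in price_law. \<not> c < bid a" by (auto dest: AE_not_in)
    have "mean_gain r a = 0" for r
    proof -
      have "mean_gain r a = (\<integral>\<^sup>+c. 0 \<partial>price_law)"
        unfolding mean_gain_def using AE by (intro nn_integral_cong_AE, eventually_elim) simp
      then show ?thesis by simp
    qed
    then show ?thesis using True by simp
  qed (simp add: h_eq)
  have parts: "surplus a = ennreal (enn2real (surplus a))" "loss a = ennreal (enn2real (loss a))" for a
    using surplus_loss by simp_all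
  have whp: "win a * ennreal (h a) = ennreal (enn2real (surplus a) - enn2real (loss a))" for a
    using wh[of a] by (simp add: win_eq_win_prob ennreal_mult'[symmetric])
  have whn: "win a * ennreal (- h a) = ennreal (enn2real (loss a) - enn2real (surplus a))" for a
    using wh[of a] by (simp add: win_eq_win_prob ennreal_mult'[symmetric])
  have pos: "win a * ennreal (h a) + loss a = surplus a" "win a * ennreal (- h a) = 0"
    if "enn2real (loss a) \<le> enn2real (surplus a)" for a
  proof -
    have "ennreal (enn2real (surplus a) - enn2real (loss a)) + ennreal (enn2real (loss a)) = ennreal (enn2real (surplus a))"
      using that by (subst ennreal_plus[symmetric]) auto
    then show "win a * ennreal (h a) + loss a = surplus a" by (simp add: whp parts[symmetric])
    show "win a * ennreal (- h a) = 0" using that by (simp add: whn ennreal_neg)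
  qed
  have neg: "win a * ennreal (- h a) + surplus a = loss a" "win a * ennreal (h a) = 0"
    if "enn2real (surplus a) \<le> enn2real (loss a)" for a
  proof -
    have "ennreal (enn2real (loss a) - enn2real (surplus a)) + ennreal (enn2real (surplus a)) = ennreal (enn2real (loss a))"
      using that by (subst ennreal_plus[symmetric]) auto
    then show "win a * ennreal (- h a) + surplus a = loss a" by (simp add: whn parts[symmetric])
    show "win a * ennreal (h a) = 0" using that by (simp add: whp ennreal_neg)
  qed
  \<comment> \<open>The positive part of \<open>h\<close> does not reproduce \<open>surplus\<close>:
    averaging over prices lets gains and losses cancel first. Adding the opposite parts on both
    sides states the balance without subtraction, and linearity of \<open>total_gain\<close> carries
    it over to the integrals.\<close>
  have bal: "win a * ennreal (h a) + loss a = win a * ennreal (- h a) + surplus a" for a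
    by (cases rule: linorder_le_cases[of "enn2real (surplus a)" "enn2real (loss a)"]) (simp_all add: pos neg)
  have le: "win a * ennreal (h a) \<le> surplus a" "win a * ennreal (- h a) \<le> loss a" for a
  proof -
    have "ennreal (enn2real (surplus a) - enn2real (loss a)) \<le> ennreal (enn2real (surplus a))"
      "ennreal (enn2real (loss a) - enn2real (surplus a)) \<le> ennreal (enn2real (loss a))"
      by (simp_all add: ennreal_leI)
    then show "win a * ennreal (h a) \<le> surplus a" "win a * ennreal (- h a) \<le> loss a"
      by (simp_all only: whp whn parts[symmetric])
  qed
  define P where "P = total_gain 0 (\<lambda>a. win a * ennreal (h a)) 0"
  define N where "N = total_gain 0 (\<lambda>a. win a * ennreal (- h a)) 0"
  have fin: "total_gain 0 surplus 0 < \<top>" "total_gain 0 loss 0 < \<top>"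
    using value_converges_finite[OF conv order.refl] total_gain_first_le[of surplus 0] total_gain_first_le[of loss 0]
    by (auto intro: order.strict_trans1)
  have PN: "P < \<top>" "N < \<top>"
    unfolding P_def N_def
    by (rule order.strict_trans1[OF total_gain_mono[OF le(1)] fin(1)])
       (rule order.strict_trans1[OF total_gain_mono[OF le(2)] fin(2)])
  have "P + total_gain 0 loss 0 = total_gain 0 (\<lambda>a. win a * ennreal (h a) + loss a) 0"
    unfolding P_def by (rule total_gain_add[symmetric]) measurable
  also have "\<dots> = N + total_gain 0 surplus 0"
    unfolding N_def bal by (rule total_gain_add) measurable
  finally have "P + total_gain 0 loss 0 = N + total_gain 0 surplus 0" .
  then have eq: "enn2real P - enn2real N = enn2real (total_gain 0 surplus 0) - enn2real (total_gain 0 loss 0)"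
    using fin PN by (auto simp: enn2real_plus dest!: arg_cong[of _ _ enn2real])
  let ?X = "\<lambda>\<omega>. h (first_win_age (source_path \<omega>)) * indicator wins_in_time \<omega>"
  have P: "(\<integral>\<^sup>+\<omega>. ennreal (?X \<omega>) \<partial>M) = P" and N: "(\<integral>\<^sup>+\<omega>. ennreal (- ?X \<omega>) \<partial>M) = N"
    unfolding P_def N_def
    by (subst nn_integral_first_win[symmetric], simp, intro nn_integral_cong, simp add: indicator_def)+
  have "integrable M ?X" using P N PN by (simp add: real_integrable_def top.not_eq_extremum)
  then show ?thesis
    using P N eq by (simp add: real_lebesgue_integral_def)
qed

text \<open>The value, the mean number of wins and the conditional expectation are compared after
  multiplication by \<open>1 - p\<close>, where they become \<open>D\<close>, \<open>p\<close> and a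
  quotient \<open>D / p\<close>.\<close>

lemma policy_value_0:
  assumes conv: "value_converges M \<gamma> k T C b 0"
  shows "policy_value M \<gamma> k T C b 0 =
    (\<integral>\<omega>. real (number_won b (\<lambda>i. T i \<omega>) (\<lambda>i. C i \<omega>) (T\<^sub>\<gamma> \<omega>)) \<partial>M) *
    expectation_given M
      (\<lambda>\<omega>. utility_given_win q (k (real_of_ereal (win_age b (\<lambda>i. T i \<omega>) (\<lambda>i. C i \<omega>))))
        (b (real_of_ereal (win_age b (\<lambda>i. T i \<omega>) (\<lambda>i. C i \<omega>)))))
      wins_in_time"
    (is "?V = ?n * expectation_given M ?X _")
proof -
  define h where "h = (\<lambda>a. utility_given_win q (worth a) (bid a))"
  define p where "p = prob wins_in_time"
  define D where "D = (\<integral>\<omega>. h (first_win_age (source_path \<omega>)) * indicator wins_in_time \<omega> \<partial>M)"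
  have h_eq: "h a = (enn2real (surplus a) - enn2real (loss a)) / win_prob a" for a
    by (simp add: h_def utility_given_win_def surplus_loss win_prob_eq)
  have [measurable]: "h \<in> borel_measurable borel" unfolding h_eq by measurable
  have X: "?X \<omega> = h (first_win_age (source_path \<omega>))" if "\<omega> \<in> space M" for \<omega>
    using win_age_source_path(3)[OF that]
    by (simp add: win_age_source_path(2)[OF that] h_def worth_def bid_def)
  have p: "total_gain 0 win 0 = ennreal p" by (simp add: p_def prob_wins_in_time)
  have "ennreal p \<le> ennreal (\<mu> / (\<mu> + \<gamma>))" using first_win_le[of 0] by (simp add: p)
  then have p1: "p < 1" using mu_pos gamma_pos
    by (subst (asm) ennreal_le_iff) (auto intro: order.strict_trans1)
  have p0: "0 \<le> p" by (simp add: p_def)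
  have renewal: "enn2real (total_gain 1 u 0) * (1 - p) = enn2real (total_gain 0 u 0)"
    if [measurable]: "u \<in> borel_measurable borel" and fin: "total_gain 1 u 0 < \<top>" for u
  proof -
    have "total_gain 0 u 0 < \<top>" using total_gain_first_le[of u 0] fin by (auto intro: order.strict_trans1)
    moreover have "total_gain 1 u 0 * ennreal p < \<top>" using fin by (simp add: ennreal_mult_less_top)
    ultimately have "enn2real (total_gain 1 u 0) = enn2real (total_gain 0 u 0) + enn2real (total_gain 1 u 0) * p"
      using p0 arg_cong[OF total_gain_at_0[of u], of enn2real] by (simp add: p enn2real_plus enn2real_mult)
    then show ?thesis by (simp add: algebra_simps)
  qed
  have V: "?V * (1 - p) = D"
    using value_converges_finite[OF conv order.refl]
    unfolding policy_value_eq[OF conv order.refl] D_def h_def integral_first_win[OF conv]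
    by (simp add: left_diff_distrib renewal)
  have "total_gain 1 win 0 < \<top>" using total_wins_le[of 0] by (rule order.strict_trans1) simp
  \<comment> \<open>Renewal for the gain \<open>win\<close>: its contribution from the first win is
    \<open>p\<close> itself.\<close>
  then have n: "?n * (1 - p) = p"
    using p0 by (simp add: expectation_number_won renewal p)
  show ?thesis
  proof (cases "p = 0")
    \<comment> \<open>Here the conditional expectation carries no information, but \<open>D\<close>
      vanishes, and with it both the value and the mean number of wins.\<close>
    case True
    then have "wins_in_time \<in> null_sets M" by (simp add: p_def null_sets_def emeasure_eq_measure)
    then have "AE \<omega> in M. \<omega> \<notin> wins_in_time" by (rule AE_not_in)
    then have "D = (\<integral>\<omega>. 0 \<partial>M)"
      unfolding D_def by (intro integral_cong_AE) (auto elim: eventually_mono)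
    then show ?thesis using V n True by simp
  next
    case False
    have "expectation_given M ?X wins_in_time = (\<integral>\<omega>. h (first_win_age (source_path \<omega>)) \<partial>uniform_measure M wins_in_time)"
      unfolding expectation_given_def by (intro Bochner_Integration.integral_cong refl X) simp
    also have "uniform_measure M wins_in_time = density M (\<lambda>\<omega>. ennreal (indicator wins_in_time \<omega> / p))"
    proof -
      have "0 < p" using False p0 by simp
      then have "indicator wins_in_time \<omega> / emeasure M wins_in_time = ennreal (indicator wins_in_time \<omega> / p)" for \<omega>
        by (simp add: p_def[symmetric] emeasure_eq_measure divide_ennreal flip: ennreal_indicator)
      then show ?thesis by (simp add: uniform_measure_def)
    qed
    also have "(\<integral>\<omega>. h (first_win_age (source_path \<omega>)) \<partial>density M (\<lambda>\<omega>. ennreal (indicator wins_in_time \<omega> / p))) =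
        (\<integral>\<omega>. h (first_win_age (source_path \<omega>)) * indicator wins_in_time \<omega> / p \<partial>M)"
      using p0 by (subst integral_density) (auto simp: mult.commute)
    also have "\<dots> = D / p" by (simp add: D_def)
    finally have X_given: "expectation_given M ?X wins_in_time = D / p" .
    have "(?n * expectation_given M ?X wins_in_time) * (1 - p) = (?n * (1 - p)) * (D / p)"
      by (simp only: X_given ac_simps)
    also have "\<dots> = ?V * (1 - p)" using False by (simp only: n V) simp
    finally have "(?n * expectation_given M ?X wins_in_time) * (1 - p) = ?V * (1 - p)" .
    then show ?thesis using p1 by simp
  qed
qed

end

theorem lemma8:
  fixes M :: "'a measure"
    and \<mu> \<gamma> :: real
    and q k b :: "real \<Rightarrow> real"
    and T C :: "nat \<Rightarrow> 'a \<Rightarrow> real"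
    and T\<^sub>\<gamma> :: "'a \<Rightarrow> real"
  assumes "prob_space M"
    and "0 < \<mu>" and "0 < \<gamma>"
    and arrivals: "poisson_arrivals M \<mu> T"
    and prices_nonneg: "\<And>i. AE \<omega> in M. 0 \<le> C i \<omega>"
    and prices_cdf: "\<And>i. cdf (distr M borel (C i)) = q"
    and win_prob: "\<And>i \<beta>. 0 \<le> \<beta> \<Longrightarrow> measure M {\<omega> \<in> space M. C i \<omega> < \<beta>} = q \<beta>"
    and end_time: "distributed M lborel T\<^sub>\<gamma> (exponential_density \<gamma>)"
    and independent: "prob_space.indep_vars M (\<lambda>_. borel) (sources T C T\<^sub>\<gamma>) UNIV"
    and k_mono: "mono_on {0..} k"
    and k_bounded: "bounded (k ` {0..})"
    and policy: "b \<in> policies"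
    and converges: "value_converges M \<gamma> k T C b 0"
  defines "V \<equiv> policy_value M \<gamma> k T C b"
    and "A \<equiv> cumulative_rate \<gamma> \<mu> q b"
    and "N \<equiv> (\<lambda>\<omega>. number_won b (\<lambda>i. T i \<omega>) (\<lambda>i. C i \<omega>) (T\<^sub>\<gamma> \<omega>))"
    and "T\<^sub>w \<equiv> (\<lambda>\<omega>. win_age b (\<lambda>i. T i \<omega>) (\<lambda>i. C i \<omega>))"
  shows "(\<forall>\<tau>\<ge>0. V \<tau> =
            exp (A \<tau>) * (V 0 - (LBINT t:{0..\<tau>}. exp (- A t) * \<mu> * utility q (V 0 + k t) (b t)))) \<and>
         V 0 = (\<integral>\<omega>. real (N \<omega>) \<partial>M) *
           expectation_given M
             (\<lambda>\<omega>. utility_given_win q (k (real_of_ereal (T\<^sub>w \<omega>))) (b (real_of_ereal (T\<^sub>w \<omega>))))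
             {\<omega> \<in> space M. T\<^sub>w \<omega> < ereal (T\<^sub>\<gamma> \<omega>)}"
proof -
  interpret auction_model M \<mu> \<gamma> q k b T C T\<^sub>\<gamma>
    by (intro auction_model.intro auction_model_axioms.intro) fact+
  show ?thesis
    using policy_value_formula[OF converges] policy_value_0[OF converges]
    by (simp add: V_def A_def N_def T\<^sub>w_def wins_in_time_def)
qed

end
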